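(* Let $\alpha>0$, $B\in\mathbb{R}$, and let $w:\{0,1,2,\dots\}\to(0,\infty)$ satisfy $\frac{1}{w(n)}=n^{\alpha}\left(1+\frac{2B}{n}+O\left(\frac{1}{n^2}\right)\right)$ as $n\to\infty$. For $*\in\{-,+,0\}$ let $(\mathfrak{B}^*_n,\mathfrak{R}^*_n)_{n\ge0}$ be the generalized Pólya urn process of type $*$ associated with $w$, with $\mathfrak{D}^*_n=\mathfrak{R}^*_n-\mathfrak{B}^*_n$ and $\tau_n^{\mathfrak{B}^*}$ the number of draws until the $n$-th blue ball is drawn. Then $$\lim_{n\to\infty}\mathbb{E}\left[\mathfrak{D}^+_{\tau_n^{\mathfrak{B}^+}}\right]=\frac{1}{2(2\alpha+1)},\qquad \lim_{n\to\infty}\mathbb{E}\left[\mathfrak{D}^-_{\tau_n^{\mathfrak{B}^-}}\right]=\frac{-(4\alpha+1)}{2(2\alpha+1)},\qquad \lim_{n\to\infty}\mathbb{E}\left[\mathfrak{D}^0_{\tau_n^{\mathfrak{B}^0}}\right]=\frac{-\alpha}{2\alpha+1}.$$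
   Context: No monotonicity of $w$ is assumed. Given sequences of positive numbers $\{b(i)\}_{i\ge0}$ and $\{r(i)\}_{i\ge0}$, the generalized Pólya urn process $\{(\mathfrak{B}_n,\mathfrak{R}_n)\}_{n\ge0}$ is the Markov chain on $\{0,1,2,\dots\}^2$ started at $(0,0)$ which from state $(i,j)$ moves to $(i+1,j)$ with probability $\frac{b(i)}{b(i)+r(j)}$ and to $(i,j+1)$ with probability $\frac{r(j)}{b(i)+r(j)}$. Here $\mathfrak{B}_n$ and $\mathfrak{R}_n$ are the numbers of blue and red balls drawn in the first $n$ draws. For $*\in\{-,+,0\}$, the urn process of type $*$ associated with $w$, denoted $(\mathfrak{B}^*_n,\mathfrak{R}^*_n)_{n\ge0}$, is the one with $b=b^*$, $r=r^*$, where for $i\ge0$: $b^-(i)=w(2i)$, $r^-(i)=w(2i+1)$; $b^+(i)=w(2i+1)$, $r^+(i)=w(2i)$; $b^0(i)=r^0(i)=w(2i)$. The discrepancy is $\mathfrak{D}^*_n=\mathfrak{R}^*_n-\mathfrak{B}^*_n$. The times $\tau_k^{\mathfrak{B}^*}$ are defined by $\tau_0^{\mathfrak{B}^*}=0$ and $\tau_k^{\mathfrak{B}^*}=\inf\{n>\tau_{k-1}^{\mathfrak{B}^*}:\mathfrak{B}^*_n=\mathfrak{B}^*_{n-1}+1\}$ for $k\ge1$. *)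

theory Defs
  imports "HOL-Probability.Probability" "HOL-Library.Landau_Symbols"
begin

definition urn_kernel ::
  "(nat \<Rightarrow> real) \<Rightarrow> (nat \<Rightarrow> real) \<Rightarrow> nat \<times> nat \<Rightarrow> nat \<times> nat \<Rightarrow> real" where
  "urn_kernel b r s t =
     (if t = (fst s + 1, snd s) then b (fst s) / (b (fst s) + r (snd s))
      else if t = (fst s, snd s + 1) then r (snd s) / (b (fst s) + r (snd s))
      else 0)"

(* The Markov property is stated through the finite-dimensional distributions. This is
   P(X (n+1) = x (n+1) | X 0 = x 0, ..., X n = x n) = urn_kernel b r (x n) (x (n+1))
   multiplied out, so that conditioning on null events needs no special treatment.
   X n is the pair (blue balls, red balls) drawn in the first n draws. *)
locale polya_urn = prob_space M for M :: "'a measure" +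
  fixes b r :: "nat \<Rightarrow> real" and X :: "nat \<Rightarrow> 'a \<Rightarrow> nat \<times> nat"
  assumes blue_weights_pos: "b i > 0"
    and red_weights_pos: "r i > 0"
    and measurable_state: "X n \<in> measurable M (count_space UNIV)"
    and start: "AE \<omega> in M. X 0 \<omega> = (0, 0)"
    and markov:
      "\<P>(\<omega> in M. \<forall>k\<le>Suc n. X k \<omega> = x k) =
         \<P>(\<omega> in M. \<forall>k\<le>n. X k \<omega> = x k) * urn_kernel b r (x n) (x (Suc n))"

datatype urn_type = Urn_Minus | Urn_Plus | Urn_Zero

fun blue_weight :: "urn_type \<Rightarrow> (nat \<Rightarrow> real) \<Rightarrow> nat \<Rightarrow> real" where
  "blue_weight Urn_Minus w i = w (2 * i)"
| "blue_weight Urn_Plus w i = w (2 * i + 1)"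
| "blue_weight Urn_Zero w i = w (2 * i)"

fun red_weight :: "urn_type \<Rightarrow> (nat \<Rightarrow> real) \<Rightarrow> nat \<Rightarrow> real" where
  "red_weight Urn_Minus w i = w (2 * i + 1)"
| "red_weight Urn_Plus w i = w (2 * i)"
| "red_weight Urn_Zero w i = w (2 * i)"

definition typed_urn ::
  "urn_type \<Rightarrow> (nat \<Rightarrow> real) \<Rightarrow> 'a measure \<Rightarrow> (nat \<Rightarrow> 'a \<Rightarrow> nat \<times> nat) \<Rightarrow> bool" where
  "typed_urn s w M X \<longleftrightarrow> polya_urn M (blue_weight s w) (red_weight s w) X"

definition blue :: "(nat \<Rightarrow> 'a \<Rightarrow> nat \<times> nat) \<Rightarrow> nat \<Rightarrow> 'a \<Rightarrow> nat" where
  "blue X n \<omega> = fst (X n \<omega>)"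

definition red :: "(nat \<Rightarrow> 'a \<Rightarrow> nat \<times> nat) \<Rightarrow> nat \<Rightarrow> 'a \<Rightarrow> nat" where
  "red X n \<omega> = snd (X n \<omega>)"

definition discrepancy :: "(nat \<Rightarrow> 'a \<Rightarrow> nat \<times> nat) \<Rightarrow> nat \<Rightarrow> 'a \<Rightarrow> real" where
  "discrepancy X n \<omega> = real (red X n \<omega>) - real (blue X n \<omega>)"

(* In enat the infimum of the empty set is \<infinity>: the value if no k-th blue ball is drawn. *)
fun blue_time :: "(nat \<Rightarrow> 'a \<Rightarrow> nat \<times> nat) \<Rightarrow> nat \<Rightarrow> 'a \<Rightarrow> enat" where
  "blue_time X 0 \<omega> = 0"
| "blue_time X (Suc k) \<omega> =
     Inf {enat n | n. enat n > blue_time X k \<omega> \<and> blue X n \<omega> = blue X (n - 1) \<omega> + 1}"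

(* Only meaningful where blue_time X n is finite, since the_enat \<infinity> is unspecified. *)
definition discrepancy_at_blue :: "(nat \<Rightarrow> 'a \<Rightarrow> nat \<times> nat) \<Rightarrow> nat \<Rightarrow> 'a \<Rightarrow> real" where
  "discrepancy_at_blue X n \<omega> = discrepancy X (the_enat (blue_time X n \<omega>)) \<omega>"

(* lebesgue_integral is 0 on non-integrable functions; this predicate says that the
   expectation of the discrepancy at the n-th blue ball genuinely exists. *)
definition mean_at_blue_exists ::
  "'a measure \<Rightarrow> (nat \<Rightarrow> 'a \<Rightarrow> nat \<times> nat) \<Rightarrow> nat \<Rightarrow> bool" where
  "mean_at_blue_exists M X n \<longleftrightarrow>
     (AE \<omega> in M. blue_time X n \<omega> < \<infinity>) \<and> integrable M (discrepancy_at_blue X n)"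

end

theory Submission
  imports Defs "HOL-Real_Asymp.Real_Asymp"
begin

text \<open>
  Write \<open>\<beta> i = 1 / b i\<close> and \<open>\<rho> j = 1 / r j\<close> for the mean waiting times of the two colours in the
  continuous-time embedding of the urn, and let \<open>R\<close> be the number of red balls present when the
  \<open>n\<close>-th blue ball is drawn. The embedding itself is only a guide: everything is read off from the law
  of \<open>R\<close>. Splitting a visit to the state \<open>(n, j)\<close> according to the colour of the last ball gives a
  balance equation between the laws for \<open>n\<close> and \<open>n + 1\<close> (\<open>blue_at_balance\<close>). It is an implicit Euler
  step for the pure birth process with rates \<open>r\<close>, run for time \<open>\<beta> n\<close>, and tested against a function
  \<open>\<phi>\<close> it becomes an exact one-step formula for the mean of \<open>\<phi> R\<close> (\<open>E_step\<close>).

  Put \<open>Y = (\<Sum>i<R. \<rho> i) - (\<Sum>i<n. \<beta> i)\<close> and let \<open>S k\<close> be the sum of the \<open>\<rho> i ^ k\<close> with \<open>i < R\<close> plus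
  \<open>(-1) ^ k\<close> times the sum of the \<open>\<beta> i ^ k\<close> with \<open>i < n\<close>. The coefficients of the polynomial
  \<open>(\<Prod>i<R. 1 + \<lambda> * \<rho> i) * (\<Prod>i<n. 1 - \<lambda> * \<beta> i)\<close> in \<open>\<lambda>\<close> are polynomials in \<open>Y\<close> and the \<open>S k\<close>,
  and the one-step formula shows that all of them except the constant one have mean zero. The first,
  second and fourth coefficient give \<open>Y\<close> mean zero (\<open>E_Y\<close>), identify its second moment with the mean
  of \<open>S 2\<close> (\<open>E_Y_power2\<close>), and express its fourth moment by terms of lower order (\<open>E_Y_power4\<close>).

  Now let \<open>\<rho> j = j powr \<alpha> * (1 + c / j + o (1 / j))\<close>, and \<open>\<beta>\<close> likewise with \<open>c'\<close> in place of \<open>c\<close>.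
  With \<open>x = R / n\<close> and \<open>K = (x powr (\<alpha> + 1) - 1) / (\<alpha> + 1)\<close>, the variable \<open>Y\<close> is
  \<open>n powr (\<alpha> + 1) * K\<close> up to lower order, and the identities yield
  \<open>n * E K \<longlonglongrightarrow> (c' - c) / \<alpha>\<close> (\<open>K_limit\<close>), \<open>n * E (K\<^sup>2) \<longlonglongrightarrow> 2 / (2 * \<alpha> + 1)\<close> (\<open>K_power2_limit\<close>) and
  \<open>n * E (K ^ 4) \<longlonglongrightarrow> 0\<close> (\<open>K_power4_tendsto_0\<close>). Inverting \<open>K\<close> to second order,
  \<open>x - 1 = K - \<alpha> / 2 * K\<^sup>2\<close> with an error controlled by a small multiple of \<open>K\<^sup>2\<close> and a multiple of
  \<open>K ^ 4\<close>. Multiplying by \<open>n\<close> and taking means gives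
  \<open>E (R - n) \<longlonglongrightarrow> (c' - c) / \<alpha> - \<alpha> / (2 * \<alpha> + 1)\<close> (\<open>red_excess_limit\<close>). The first summand is a drift
  caused by the different waiting times of the colours; the second is the effect of the curvature of
  \<open>x powr (\<alpha> + 1)\<close> on the fluctuations.

  Only the quotients \<open>r j / b n\<close> matter for the law of \<open>R\<close>, so the waiting times may be divided by
  \<open>2 powr \<alpha>\<close>. Then the weights \<open>w (2 * i)\<close> correspond to the coefficient \<open>B\<close> and the weights
  \<open>w (2 * i + 1)\<close> to \<open>B + \<alpha> / 2\<close> (\<open>arithmetic_subsequence_asymp\<close>), so that \<open>(c' - c) / \<alpha>\<close> is
  \<open>1 / 2\<close>, \<open>- 1 / 2\<close> and \<open>0\<close> for the types \<open>+\<close>, \<open>-\<close> and \<open>0\<close>.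
\<close>

section \<open>Asymptotics of sums of power-law sequences\<close>

text \<open>
  A Stolz--Cesaro argument: a term \<open>t j\<close> that is small relative to \<open>j powr (\<gamma> - 1)\<close> is small relative to
  the increment of \<open>j powr \<gamma>\<close>, and these increments telescope.
\<close>
lemma sum_over_powr_tendsto_0:
  fixes t :: "nat \<Rightarrow> real"
  assumes \<gamma>: "\<gamma> > 0" and t: "(\<lambda>j. t j / real j powr (\<gamma> - 1)) \<longlonglongrightarrow> 0"
  shows "(\<lambda>m. (\<Sum>j<m. t j) / real m powr \<gamma>) \<longlonglongrightarrow> 0"
proof (rule LIMSEQ_I)
  fix e :: real assume e: "e > 0"
  define D where "D j = real (Suc j) powr \<gamma> - real j powr \<gamma>" for j
  have "(\<lambda>j. D j / real j powr (\<gamma> - 1)) \<longlonglongrightarrow> \<gamma>"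
    unfolding D_def using \<gamma> by real_asymp
  then have "eventually (\<lambda>j. D j / real j powr (\<gamma> - 1) > \<gamma> / 2) sequentially"
    by (rule order_tendstoD) (use \<gamma> in auto)
  moreover have "eventually (\<lambda>j. norm (t j / real j powr (\<gamma> - 1)) < e * \<gamma> / 4) sequentially"
    using t e \<gamma> by (intro order_tendstoD(2)[OF tendsto_norm_zero[OF t]]) auto
  ultimately have "eventually (\<lambda>j. \<bar>t j\<bar> \<le> e / 2 * D j) sequentially"
    using eventually_gt_at_top[of 0]
  proof eventually_elim
    case (elim j)
    then have pos: "real j powr (\<gamma> - 1) > 0" by simp
    have "\<bar>t j\<bar> \<le> e * \<gamma> / 4 * real j powr (\<gamma> - 1)"
      using elim pos by (simp add: field_simps abs_mult)
    also have "\<dots> = e / 2 * (\<gamma> / 2 * real j powr (\<gamma> - 1))" by simp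
    also have "\<dots> \<le> e / 2 * D j"
      using elim(1) pos e by (intro mult_left_mono) (auto simp: field_simps)
    finally show ?case .
  qed
  then obtain N where N: "\<And>j. j \<ge> N \<Longrightarrow> \<bar>t j\<bar> \<le> e / 2 * D j"
    by (auto simp: eventually_at_top_linorder)
  define C where "C = (\<Sum>j<N. \<bar>t j\<bar>)"
  have bound: "\<bar>\<Sum>j<m. t j\<bar> \<le> C + e / 2 * real m powr \<gamma>" if "m \<ge> N" for m
    using that
  proof (induction m rule: dec_induct)
    case base
    show ?case unfolding C_def using e
      by (intro order.trans[OF sum_abs]) auto
  next
    case (step m)
    have "\<bar>\<Sum>j<Suc m. t j\<bar> \<le> \<bar>\<Sum>j<m. t j\<bar> + \<bar>t m\<bar>" by simp
    also have "\<dots> \<le> C + e / 2 * real m powr \<gamma> + e / 2 * D m"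
      using step N[of m] by auto
    also have "\<dots> = C + e / 2 * real (Suc m) powr \<gamma>"
      by (simp add: D_def algebra_simps)
    finally show ?case .
  qed
  have "(\<lambda>m. C / real m powr \<gamma>) \<longlonglongrightarrow> 0" using \<gamma> by real_asymp
  then have "eventually (\<lambda>m. C / real m powr \<gamma> < e / 2) sequentially"
    by (rule order_tendstoD) (use e in auto)
  then have "eventually (\<lambda>m. norm ((\<Sum>j<m. t j) / real m powr \<gamma> - 0) < e) sequentially"
    using eventually_ge_at_top[of N] eventually_gt_at_top[of 0]
  proof eventually_elim
    case (elim m)
    then have pos: "real m powr \<gamma> > 0" by simp
    have "\<bar>\<Sum>j<m. t j\<bar> / real m powr \<gamma> \<le> (C + e / 2 * real m powr \<gamma>) / real m powr \<gamma>"
      using bound[of m] elim pos by (intro divide_right_mono) auto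
    also have "\<dots> = C / real m powr \<gamma> + e / 2" using pos by (simp add: field_simps)
    also have "\<dots> < e" using elim(1) by linarith
    finally show ?case by simp
  qed
  then show "\<exists>N. \<forall>m\<ge>N. norm ((\<Sum>j<m. t j) / real m powr \<gamma> - 0) < e"
    by (auto simp: eventually_at_top_linorder)
qed

lemma sum_asymp_powr:
  fixes u :: "nat \<Rightarrow> real"
  assumes \<gamma>: "\<gamma> > 0" and u: "(\<lambda>j. u j / real j powr (\<gamma> - 1)) \<longlonglongrightarrow> L"
  shows "(\<lambda>m. (\<Sum>j<m. u j) / real m powr \<gamma>) \<longlonglongrightarrow> L / \<gamma>"
proof -
  define t where "t j = u j - L / \<gamma> * (real (Suc j) powr \<gamma> - real j powr \<gamma>)" for j
  have "(\<lambda>j. (real (Suc j) powr \<gamma> - real j powr \<gamma>) / real j powr (\<gamma> - 1)) \<longlonglongrightarrow> \<gamma>"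
    using \<gamma> by real_asymp
  from tendsto_diff[OF u tendsto_mult[OF tendsto_const[of "L / \<gamma>"] this]]
  have "(\<lambda>j. t j / real j powr (\<gamma> - 1)) \<longlonglongrightarrow> 0"
    using \<gamma> by (simp add: t_def diff_divide_distrib[of "u _"])
  then have lim: "(\<lambda>m. (\<Sum>j<m. t j) / real m powr \<gamma> + L / \<gamma>) \<longlonglongrightarrow> 0 + L / \<gamma>"
    using sum_over_powr_tendsto_0[OF \<gamma>] by (intro tendsto_add tendsto_const) blast
  have sumt: "(\<Sum>j<m. t j) = (\<Sum>j<m. u j) - L / \<gamma> * real m powr \<gamma>" for m
    unfolding t_def sum_subtractf sum_distrib_left[symmetric] 
    using sum_lessThan_telescope[of "\<lambda>j. real j powr \<gamma>" m] \<gamma> by (simp add: sum_subtractf)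
  show ?thesis
  proof (rule Lim_transform_eventually)
    show "(\<lambda>m. (\<Sum>j<m. t j) / real m powr \<gamma> + L / \<gamma>) \<longlonglongrightarrow> L / \<gamma>" using lim by simp
    show "eventually (\<lambda>m. (\<Sum>j<m. t j) / real m powr \<gamma> + L / \<gamma> = (\<Sum>j<m. u j) / real m powr \<gamma>) sequentially"
      using eventually_gt_at_top[of 0]
      by eventually_elim (simp add: sumt diff_divide_distrib)
  qed
qed

text \<open>
  The constant \<open>- 1 / 2\<close> is the Euler--Maclaurin correction for a sum that omits its upper end point.
\<close>
lemma sum_asymp_powr_second_order:
  fixes u :: "nat \<Rightarrow> real"
  assumes \<alpha>: "\<alpha> > 0"
    and u: "(\<lambda>j. (u j - real j powr \<alpha>) / real j powr (\<alpha> - 1)) \<longlonglongrightarrow> c"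
  shows "(\<lambda>m. ((\<Sum>j<m. u j) - real m powr (\<alpha> + 1) / (\<alpha> + 1)) / real m powr \<alpha>) \<longlonglongrightarrow> c / \<alpha> - 1 / 2"
proof -
  define D where "D j = (real (Suc j) powr (\<alpha> + 1) - real j powr (\<alpha> + 1)) / (\<alpha> + 1) - real j powr \<alpha>" for j
  have "(\<lambda>j. D j / real j powr (\<alpha> - 1)) \<longlonglongrightarrow> \<alpha> / 2"
    unfolding D_def using \<alpha> by real_asymp
  from tendsto_diff[OF u this]
  have "(\<lambda>j. (u j - real j powr \<alpha> - D j) / real j powr (\<alpha> - 1)) \<longlonglongrightarrow> c - \<alpha> / 2"
    by (simp add: diff_divide_distrib)
  from sum_asymp_powr[OF \<alpha> this]
  have "(\<lambda>m. (\<Sum>j<m. u j - real j powr \<alpha> - D j) / real m powr \<alpha>) \<longlonglongrightarrow> c / \<alpha> - 1 / 2"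
    using \<alpha> by (simp add: field_simps)
  moreover have "(\<Sum>j<m. u j - real j powr \<alpha> - D j) = (\<Sum>j<m. u j) - real m powr (\<alpha> + 1) / (\<alpha> + 1)" for m
    using sum_lessThan_telescope[of "\<lambda>j. real j powr (\<alpha> + 1)" m] \<alpha>
    by (simp add: D_def sum_subtractf sum_divide_distrib[symmetric])
  ultimately show ?thesis by simp
qed

lemma first_order_of_second_order:
  fixes u :: "nat \<Rightarrow> real"
  assumes u: "(\<lambda>j. (u j - real j powr \<alpha>) / real j powr (\<alpha> - 1)) \<longlonglongrightarrow> c"
  shows "(\<lambda>j. u j / real j powr \<alpha>) \<longlonglongrightarrow> 1"
proof (rule Lim_transform_eventually)
  have "(\<lambda>j. 1 / real j) \<longlonglongrightarrow> 0" by real_asymp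
  from tendsto_add[OF tendsto_const[of 1] tendsto_mult[OF u this]]
  show "(\<lambda>j. 1 + (u j - real j powr \<alpha>) / real j powr (\<alpha> - 1) * (1 / real j)) \<longlonglongrightarrow> 1" by simp
  show "eventually (\<lambda>j. 1 + (u j - real j powr \<alpha>) / real j powr (\<alpha> - 1) * (1 / real j) = u j / real j powr \<alpha>) sequentially"
    using eventually_gt_at_top[of 0]
    by eventually_elim (simp add: powr_diff field_simps)
qed

lemma power_sum_asymp:
  fixes u :: "nat \<Rightarrow> real"
  assumes u: "(\<lambda>j. u j / real j powr \<alpha>) \<longlonglongrightarrow> 1" and \<alpha>: "\<alpha> > 0"
  shows "(\<lambda>m. (\<Sum>j<m. u j ^ k) / real m powr (real k * \<alpha> + 1)) \<longlonglongrightarrow> 1 / (real k * \<alpha> + 1)"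
proof (rule sum_asymp_powr)
  show "0 < real k * \<alpha> + 1" using \<alpha> by (simp add: add_nonneg_pos)
  have "(\<lambda>j. (u j / real j powr \<alpha>) ^ k) \<longlonglongrightarrow> 1 ^ k" by (intro tendsto_power u)
  moreover have "(\<lambda>j. (u j / real j powr \<alpha>) ^ k) = (\<lambda>j. u j ^ k / (real j powr \<alpha>) ^ k)"
    by (simp add: power_divide)
  ultimately have "(\<lambda>j. u j ^ k / (real j powr \<alpha>) ^ k) \<longlonglongrightarrow> 1" by simp
  then show "(\<lambda>j. u j ^ k / real j powr (real k * \<alpha> + 1 - 1)) \<longlonglongrightarrow> 1"
  proof (rule Lim_transform_eventually)
    show "eventually (\<lambda>j. u j ^ k / (real j powr \<alpha>) ^ k = u j ^ k / real j powr (real k * \<alpha> + 1 - 1)) sequentially"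
      using eventually_gt_at_top[of 0]
      by eventually_elim (simp add: powr_powr[symmetric] powr_realpow mult.commute)
  qed
qed

lemma filterlim_of_powr_asymp:
  fixes u :: "nat \<Rightarrow> real"
  assumes u: "(\<lambda>j. u j / real j powr \<alpha>) \<longlonglongrightarrow> 1" and \<alpha>: "\<alpha> > 0"
  shows "filterlim u at_top sequentially"
proof -
  have "filterlim (\<lambda>j. real j powr \<alpha>) at_top sequentially" using \<alpha> by real_asymp
  with u have "filterlim (\<lambda>j. u j / real j powr \<alpha> * real j powr \<alpha>) at_top sequentially"
    by (intro filterlim_tendsto_pos_mult_at_top[of _ 1]) auto
  then show ?thesis
  proof (rule filterlim_mono_eventually)
    show "eventually (\<lambda>j. u j / real j powr \<alpha> * real j powr \<alpha> = u j) sequentially"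
      using eventually_gt_at_top[of 0] by eventually_elim simp
  qed auto
qed

section \<open>Elementary inequalities for powers\<close>

lemma abs_powr_minus_one_mono:
  fixes x :: real
  assumes "x \<ge> 0" "0 < \<gamma>" "\<gamma> \<le> \<delta>"
  shows "\<bar>x powr \<gamma> - 1\<bar> \<le> \<bar>x powr \<delta> - 1\<bar>"
proof (cases "x \<ge> 1")
  case True
  then have "1 \<le> x powr \<gamma>" "x powr \<gamma> \<le> x powr \<delta>"
    using assms by (auto intro: ge_one_powr_ge_zero powr_mono)
  then show ?thesis by simp
next
  case False
  then have "x powr \<delta> \<le> x powr \<gamma>" "x powr \<gamma> \<le> 1"
    using assms by (auto intro: powr_mono' powr_le1)
  then show ?thesis by simp
qed

text \<open>
  Used with \<open>\<gamma> = k * \<alpha> + 1\<close> and \<open>\<delta> = \<alpha> + 1\<close>, to bound the \<open>k\<close>-th power sums by powers of the first.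
\<close>
lemma powr_le_one_plus_power:
  fixes x :: real
  assumes "x \<ge> 0" "0 \<le> \<gamma>" "\<gamma> \<le> real k * \<delta>"
  shows "x powr \<gamma> \<le> 1 + (x powr \<delta>) ^ k"
proof (cases "x \<ge> 1")
  case True
  have "x powr \<gamma> \<le> x powr (real k * \<delta>)" using True assms by (intro powr_mono) auto
  also have "\<dots> = (x powr \<delta>) ^ k"
    using True by (simp add: powr_powr[symmetric] powr_realpow mult.commute)
  finally show ?thesis by simp
next
  case False
  then have "x powr \<gamma> \<le> 1" using assms by (auto intro: powr_le1)
  also have "1 \<le> 1 + (x powr \<delta>) ^ k" by simp
  finally show ?thesis .
qed

lemma bound_of_powr_asymp:
  fixes u :: "nat \<Rightarrow> real"
  assumes "(\<lambda>m. u m / real m powr \<gamma>) \<longlonglongrightarrow> L" "u 0 = 0"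
  shows "\<exists>C. \<forall>m. \<bar>u m\<bar> \<le> C * real m powr \<gamma>"
proof -
  have "Bseq (\<lambda>m. u m / real m powr \<gamma>)"
    using assms(1) by (intro convergent_imp_Bseq) (auto simp: convergent_def)
  then obtain C where C: "\<And>m. \<bar>u m / real m powr \<gamma>\<bar> \<le> C" by (auto simp: Bseq_def)
  have "\<bar>u m\<bar> \<le> C * real m powr \<gamma>" for m
    using C[of m] assms(2) by (cases "m = 0") (auto simp: field_simps)
  then show ?thesis by blast
qed

lemma one_plus_power_le:
  fixes a :: real assumes "a \<ge> 0" shows "(1 + a) ^ k \<le> 2 ^ k * (1 + a ^ k)"
proof -
  have "(1 + a) ^ k \<le> (2 * max 1 a) ^ k" using assms by (intro power_mono) auto
  also have "\<dots> = 2 ^ k * (max 1 a) ^ k" by (simp add: power_mult_distrib)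
  also have "(max 1 a) ^ k \<le> 1 + a ^ k" using assms by (cases "a \<le> 1") (auto simp: max_def)
  finally show ?thesis by simp
qed

text \<open>
  Near \<open>x = 1\<close> this is the second-order expansion of the inverse of \<open>K\<close>. Away from \<open>1\<close> the value
  \<open>\<bar>K x\<bar>\<close> is bounded below, so that \<open>K x ^ 4\<close> dominates every other term. Stating the
  error with an arbitrarily small multiple of the square makes moments of even order sufficient later.
\<close>
lemma inverse_powr_expansion:
  fixes \<alpha> :: real
  assumes \<alpha>: "\<alpha> > 0"
  defines "K \<equiv> \<lambda>x::real. (x powr (\<alpha> + 1) - 1) / (\<alpha> + 1)"
  assumes \<epsilon>: "\<epsilon> > 0"
  shows "\<exists>C\<ge>0. \<forall>x\<ge>0. \<bar>x - 1 - K x + \<alpha> / 2 * (K x)\<^sup>2\<bar> \<le> \<epsilon> * (K x)\<^sup>2 + C * K x ^ 4"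
proof -
  define u where "u x = x - 1 - K x + \<alpha> / 2 * (K x)\<^sup>2" for x
  have "((\<lambda>x. u x / (K x)\<^sup>2) \<longlongrightarrow> 0) (at 1)"
  proof (rule Lim_transform_eventually)
    \<comment> \<open>In terms of \<open>g\<close> and \<open>h\<close> the quotient is \<open>(- g + \<alpha> / 2 * h\<^sup>2) / h\<^sup>2\<close>, with \<open>g\<close> tending to
      \<open>\<alpha> / 2\<close> and \<open>h\<close> to \<open>1\<close>.\<close>
    define g where "g x = (K x - (x - 1)) / (x - 1)\<^sup>2" for x
    define h where "h x = K x / (x - 1)" for x
    have "((\<lambda>x. (x powr (\<alpha> + 1) - 1 - (\<alpha> + 1) * (x - 1)) / (x - 1)\<^sup>2) \<longlongrightarrow> (\<alpha> + 1) * \<alpha> / 2) (at 1)"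
      using \<alpha> by real_asymp
    then have "((\<lambda>x. (x powr (\<alpha> + 1) - 1 - (\<alpha> + 1) * (x - 1)) / (x - 1)\<^sup>2 / (\<alpha> + 1)) \<longlongrightarrow> (\<alpha> + 1) * \<alpha> / 2 / (\<alpha> + 1)) (at 1)"
      by (rule tendsto_divide[OF _ tendsto_const]) (use \<alpha> in auto)
    moreover have "(x powr (\<alpha> + 1) - 1 - (\<alpha> + 1) * (x - 1)) / (x - 1)\<^sup>2 / (\<alpha> + 1) = g x" for x
    proof -
      have "x powr (\<alpha> + 1) - 1 = (\<alpha> + 1) * K x" using \<alpha> by (simp add: K_def)
      then show ?thesis using \<alpha> by (simp add: g_def right_diff_distrib[symmetric])
    qed
    ultimately have "(g \<longlongrightarrow> (\<alpha> + 1) * \<alpha> / 2 / (\<alpha> + 1)) (at 1)" by (simp only:)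
    moreover have "(\<alpha> + 1) * \<alpha> / 2 / (\<alpha> + 1) = \<alpha> / 2" using \<alpha> by (simp add: divide_simps)
    ultimately have g: "(g \<longlongrightarrow> \<alpha> / 2) (at 1)" by (simp only:)
    have "((\<lambda>x. (x powr (\<alpha> + 1) - 1) / (x - 1)) \<longlongrightarrow> \<alpha> + 1) (at 1)"
      using \<alpha> by real_asymp
    then have "((\<lambda>x. (x powr (\<alpha> + 1) - 1) / (x - 1) / (\<alpha> + 1)) \<longlongrightarrow> (\<alpha> + 1) / (\<alpha> + 1)) (at 1)"
      by (rule tendsto_divide[OF _ tendsto_const]) (use \<alpha> in auto)
    moreover have "(x powr (\<alpha> + 1) - 1) / (x - 1) / (\<alpha> + 1) = h x" for x
      by (simp add: h_def K_def mult.commute)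
    ultimately have "(h \<longlongrightarrow> (\<alpha> + 1) / (\<alpha> + 1)) (at 1)" by (simp only:)
    moreover have "(\<alpha> + 1) / (\<alpha> + 1) = 1" using \<alpha> by simp
    ultimately have h: "(h \<longlongrightarrow> 1) (at 1)" by (simp only:)
    have "((\<lambda>x. (- g x + \<alpha> / 2 * (h x)\<^sup>2) / (h x)\<^sup>2) \<longlongrightarrow> (- (\<alpha> / 2) + \<alpha> / 2 * 1\<^sup>2) / 1\<^sup>2) (at 1)"
      by (intro tendsto_intros g h) auto
    then show "((\<lambda>x. (- g x + \<alpha> / 2 * (h x)\<^sup>2) / (h x)\<^sup>2) \<longlongrightarrow> 0) (at 1)" by simp
    show "eventually (\<lambda>x. (- g x + \<alpha> / 2 * (h x)\<^sup>2) / (h x)\<^sup>2 = u x / (K x)\<^sup>2) (at 1)"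
    proof (rule eventually_mono[OF eventually_neq_at_within])
      fix x :: real assume "x \<noteq> 1"
      then have "- g x + \<alpha> / 2 * (h x)\<^sup>2 = u x / (x - 1)\<^sup>2"
        by (simp add: g_def h_def u_def power_divide add_divide_distrib diff_divide_distrib)
      then show "(- g x + \<alpha> / 2 * (h x)\<^sup>2) / (h x)\<^sup>2 = u x / (K x)\<^sup>2"
        using \<open>x \<noteq> 1\<close> by (simp add: h_def power_divide)
    qed
  qed
  then have "eventually (\<lambda>x. \<bar>u x / (K x)\<^sup>2\<bar> < \<epsilon>) (at 1)"
    using \<epsilon> order_tendstoD(2)[OF tendsto_rabs_zero] by blast
  then obtain \<delta> where \<delta>: "\<delta> > 0" "\<And>x. x \<noteq> 1 \<Longrightarrow> dist x 1 < \<delta> \<Longrightarrow> \<bar>u x / (K x)\<^sup>2\<bar> < \<epsilon>"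
    unfolding eventually_at by auto
  have K_ge: "\<bar>x - 1\<bar> \<le> (\<alpha> + 1) * \<bar>K x\<bar>" if "x \<ge> 0" for x
    using abs_powr_minus_one_mono[of x 1 "\<alpha> + 1"] that \<alpha> by (simp add: K_def)
  define \<kappa> where "\<kappa> = \<delta> / (\<alpha> + 1)"
  have \<kappa>: "\<kappa> > 0" using \<delta> \<alpha> by (simp add: \<kappa>_def)
  define C where "C = (\<alpha> + 2) / \<kappa> ^ 3 + \<alpha> / 2 / \<kappa>\<^sup>2"
  have C: "C \<ge> 0" unfolding C_def using \<kappa> \<alpha> by simp
  have "\<bar>u x\<bar> \<le> \<epsilon> * (K x)\<^sup>2 + C * K x ^ 4" if x: "x \<ge> 0" for x
  proof (cases "dist x 1 < \<delta>")
    case True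
    have "\<bar>u x\<bar> \<le> \<epsilon> * (K x)\<^sup>2"
    proof (cases "x = 1")
      case True
      then show ?thesis by (simp add: u_def K_def)
    next
      case False
      then have "K x \<noteq> 0" using K_ge[OF x] by auto
      then show ?thesis using \<delta>(2)[OF False True] by (simp add: field_simps)
    qed
    then show ?thesis using C by (simp add: add_increasing2)
  next
    case False
    then have "\<delta> \<le> (\<alpha> + 1) * \<bar>K x\<bar>" using K_ge[OF x] by (simp add: dist_real_def)
    then have ge: "\<kappa> \<le> \<bar>K x\<bar>" using \<alpha> by (simp add: \<kappa>_def field_simps)
    have "\<bar>u x\<bar> \<le> \<bar>x - 1\<bar> + \<bar>K x\<bar> + \<bar>\<alpha> / 2 * (K x)\<^sup>2\<bar>" unfolding u_def by linarith
    also have "\<dots> \<le> (\<alpha> + 1) * \<bar>K x\<bar> + \<bar>K x\<bar> + \<alpha> / 2 * (K x)\<^sup>2"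
      using K_ge[OF x] \<alpha> by simp
    also have "\<dots> = (\<alpha> + 2) * \<bar>K x\<bar> + \<alpha> / 2 * \<bar>K x\<bar>\<^sup>2" by (simp add: algebra_simps)
    also have "\<dots> \<le> (\<alpha> + 2) / \<kappa> ^ 3 * \<bar>K x\<bar> ^ 4 + \<alpha> / 2 / \<kappa>\<^sup>2 * \<bar>K x\<bar> ^ 4"
    proof (intro add_mono)
      have "\<kappa> ^ 3 \<le> \<bar>K x\<bar> ^ 3" using ge \<kappa> by (intro power_mono) auto
      then have "\<bar>K x\<bar> * \<kappa> ^ 3 \<le> \<bar>K x\<bar> ^ 4"
        using mult_left_mono[of "\<kappa> ^ 3" "\<bar>K x\<bar> ^ 3" "\<bar>K x\<bar>"] by (simp add: power3_eq_cube power4_eq_xxxx mult.assoc)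
      then have "(\<alpha> + 2) * (\<bar>K x\<bar> * \<kappa> ^ 3) \<le> (\<alpha> + 2) * \<bar>K x\<bar> ^ 4"
        using \<alpha> by (intro mult_left_mono) auto
      then show "(\<alpha> + 2) * \<bar>K x\<bar> \<le> (\<alpha> + 2) / \<kappa> ^ 3 * \<bar>K x\<bar> ^ 4"
        using \<kappa> by (simp add: field_simps)
      have "\<kappa>\<^sup>2 \<le> \<bar>K x\<bar>\<^sup>2" using ge \<kappa> by (intro power_mono) auto
      then have "\<bar>K x\<bar>\<^sup>2 * \<kappa>\<^sup>2 \<le> \<bar>K x\<bar> ^ 4"
        using mult_left_mono[of "\<kappa>\<^sup>2" "\<bar>K x\<bar>\<^sup>2" "\<bar>K x\<bar>\<^sup>2"] by (simp add: power2_eq_square power4_eq_xxxx mult.assoc)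
      then have "\<alpha> / 2 * (\<bar>K x\<bar>\<^sup>2 * \<kappa>\<^sup>2) \<le> \<alpha> / 2 * \<bar>K x\<bar> ^ 4"
        using \<alpha> by (intro mult_left_mono) auto
      then show "\<alpha> / 2 * \<bar>K x\<bar>\<^sup>2 \<le> \<alpha> / 2 / \<kappa>\<^sup>2 * \<bar>K x\<bar> ^ 4"
        using \<kappa> by (simp add: field_simps)
    qed
    also have "\<dots> = C * K x ^ 4" by (simp add: C_def algebra_simps)
    also have "\<dots> \<le> \<epsilon> * (K x)\<^sup>2 + C * K x ^ 4" using \<epsilon> by simp
    finally show ?thesis .
  qed
  with C show ?thesis unfolding u_def by blast
qed

text \<open>
  Here \<open>\<delta>\<close> stands for \<open>1 / n\<close>. Every occurrence of \<open>f ^ 4\<close> on the right carries a factor \<open>\<delta>\<close>, which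
  lets the fourth moment be absorbed into the left-hand side after taking means.
\<close>
lemma quartic_pointwise_bound:
  fixes f s2 s3 s4 C \<delta> :: real
  assumes C: "C \<ge> 0" and \<delta>: "0 \<le> \<delta>" "\<delta> \<le> 1"
    and s2: "\<bar>s2\<bar> \<le> C * (1 + \<bar>f\<bar> ^ 2) * \<delta>" and s3: "\<bar>s3\<bar> \<le> C * (1 + \<bar>f\<bar> ^ 3) * \<delta>\<^sup>2"
    and s4: "\<bar>s4\<bar> \<le> C * (1 + \<bar>f\<bar> ^ 4) * \<delta> ^ 3"
  shows "6 * f\<^sup>2 * s2 - 3 * s2\<^sup>2 - 8 * f * s3 + 6 * s4 \<le> C * (14 * \<delta> * f\<^sup>2 + 20 * \<delta> * f ^ 4 + 14 * \<delta> ^ 3)"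
proof -
  define a where "a = \<bar>f\<bar>"
  have a: "a \<ge> 0" "f\<^sup>2 = a\<^sup>2" "f ^ 4 = a ^ 4" by (simp_all add: a_def)
  have \<delta>2: "\<delta>\<^sup>2 \<le> \<delta>" "\<delta> ^ 3 \<le> \<delta>"
    using \<delta> power_decreasing[of 1 2 \<delta>] power_decreasing[of 1 3 \<delta>] by auto
  have "6 * f\<^sup>2 * s2 \<le> 6 * a\<^sup>2 * (C * (1 + a\<^sup>2) * \<delta>)"
    unfolding a(2) using s2 by (intro mult_left_mono) (auto simp: a_def)
  also have "\<dots> = C * (6 * \<delta> * a\<^sup>2 + 6 * \<delta> * a ^ 4)" by algebra
  finally have 1: "6 * f\<^sup>2 * s2 \<le> C * (6 * \<delta> * a\<^sup>2 + 6 * \<delta> * a ^ 4)" .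
  have "- 8 * f * s3 \<le> 8 * (a * \<bar>s3\<bar>)"
    using abs_ge_minus_self[of "f * s3"] by (simp add: a_def abs_mult)
  also have "\<dots> \<le> 8 * (a * (C * (1 + a ^ 3) * \<delta>\<^sup>2))"
    using s3 a(1) by (intro mult_left_mono) (auto simp: a_def)
  also have "\<dots> = C * (8 * (a * \<delta>\<^sup>2) + 8 * (a ^ 4 * \<delta>\<^sup>2))" by algebra
  also have "\<dots> \<le> C * (8 * (a\<^sup>2 * \<delta> + \<delta> ^ 3) + 8 * (a ^ 4 * \<delta>))"
  proof (intro mult_left_mono add_mono)
    have "0 \<le> \<delta> * ((a - \<delta> / 2)\<^sup>2 + 3 / 4 * \<delta>\<^sup>2)" using \<delta> by simp
    also have "\<dots> = a\<^sup>2 * \<delta> + \<delta> ^ 3 - a * \<delta>\<^sup>2"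
      by (simp add: power2_eq_square power3_eq_cube field_simps)
    finally show "a * \<delta>\<^sup>2 \<le> a\<^sup>2 * \<delta> + \<delta> ^ 3" by simp
  qed (use C \<delta>2 in auto)
  finally have 2: "- 8 * f * s3 \<le> C * (8 * (a\<^sup>2 * \<delta> + \<delta> ^ 3) + 8 * (a ^ 4 * \<delta>))" .
  have "6 * s4 \<le> 6 * (C * (1 + a ^ 4) * \<delta> ^ 3)"
    using s4 by (simp add: a_def)
  also have "\<dots> = C * (6 * \<delta> ^ 3 + 6 * (a ^ 4 * \<delta> ^ 3))" by algebra
  also have "\<dots> \<le> C * (6 * \<delta> ^ 3 + 6 * (a ^ 4 * \<delta>))"
    using C \<delta>2 by (intro mult_left_mono add_mono) auto
  finally have 3: "6 * s4 \<le> C * (6 * \<delta> ^ 3 + 6 * (a ^ 4 * \<delta>))" .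
  have "6 * f\<^sup>2 * s2 - 3 * s2\<^sup>2 - 8 * f * s3 + 6 * s4 \<le> 6 * f\<^sup>2 * s2 + (- 8 * f * s3) + 6 * s4" by simp
  also have "\<dots> \<le> C * (6 * \<delta> * a\<^sup>2 + 6 * \<delta> * a ^ 4) + C * (8 * (a\<^sup>2 * \<delta> + \<delta> ^ 3) + 8 * (a ^ 4 * \<delta>))
      + C * (6 * \<delta> ^ 3 + 6 * (a ^ 4 * \<delta>))"
    using 1 2 3 by linarith
  also have "\<dots> = C * (14 * \<delta> * f\<^sup>2 + 20 * \<delta> * f ^ 4 + 14 * \<delta> ^ 3)"
    unfolding a by algebra
  finally show ?thesis .
qed

section \<open>Functions of polynomial growth\<close>

text \<open>
  The test functions below all belong to this class, and it is closed under the operations that occur,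
  so that integrability reduces to one tail estimate for the law.
\<close>
definition poly_bounded :: "(nat \<Rightarrow> real) \<Rightarrow> bool" where
  "poly_bounded \<phi> \<longleftrightarrow> (\<exists>C k. \<forall>j. \<bar>\<phi> j\<bar> \<le> C * real (Suc j) ^ k)"

lemma poly_boundedI: "(\<And>j. \<bar>\<phi> j\<bar> \<le> C * real (Suc j) ^ k) \<Longrightarrow> poly_bounded \<phi>"
  by (auto simp: poly_bounded_def)

lemma poly_boundedE:
  assumes "poly_bounded \<phi>"
  obtains C k where "C \<ge> 0" "\<And>j. \<bar>\<phi> j\<bar> \<le> C * real (Suc j) ^ k"
proof -
  obtain C k where *: "\<And>j. \<bar>\<phi> j\<bar> \<le> C * real (Suc j) ^ k"
    using assms by (auto simp: poly_bounded_def)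
  have "C \<ge> 0" using *[of 0] by (simp add: order.trans[OF abs_ge_zero])
  with * that show ?thesis by blast
qed

lemma poly_bounded_mono:
  assumes "poly_bounded \<psi>" "\<And>j. \<bar>\<phi> j\<bar> \<le> \<bar>\<psi> j\<bar>"
  shows "poly_bounded \<phi>"
  using assms unfolding poly_bounded_def by (meson order.trans)

lemma poly_bounded_const: "poly_bounded (\<lambda>_. c)"
  by (rule poly_boundedI[of _ "\<bar>c\<bar>" 0]) simp

lemma poly_bounded_of_nat: "poly_bounded real"
  by (rule poly_boundedI[of _ 1 1]) simp

lemma poly_bounded_abs: "poly_bounded \<phi> \<Longrightarrow> poly_bounded (\<lambda>j. \<bar>\<phi> j\<bar>)"
  by (simp add: poly_bounded_def)

lemma poly_bounded_uminus: "poly_bounded \<phi> \<Longrightarrow> poly_bounded (\<lambda>j. - \<phi> j)"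
  by (simp add: poly_bounded_def)

lemma poly_bounded_add:
  assumes "poly_bounded \<phi>" "poly_bounded \<psi>"
  shows "poly_bounded (\<lambda>j. \<phi> j + \<psi> j)"
proof -
  obtain C k where C: "C \<ge> 0" "\<And>j. \<bar>\<phi> j\<bar> \<le> C * real (Suc j) ^ k" using assms(1) poly_boundedE by blast
  obtain D l where D: "D \<ge> 0" "\<And>j. \<bar>\<psi> j\<bar> \<le> D * real (Suc j) ^ l" using assms(2) poly_boundedE by blast
  show ?thesis
  proof (rule poly_boundedI[of _ "C + D" "max k l"])
    fix j
    have "\<bar>\<phi> j + \<psi> j\<bar> \<le> C * real (Suc j) ^ k + D * real (Suc j) ^ l"
      using C(2)[of j] D(2)[of j] by linarith
    also have "\<dots> \<le> C * real (Suc j) ^ max k l + D * real (Suc j) ^ max k l"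
      using C(1) D(1) by (intro add_mono mult_left_mono power_increasing) auto
    finally show "\<bar>\<phi> j + \<psi> j\<bar> \<le> (C + D) * real (Suc j) ^ max k l" by (simp add: algebra_simps)
  qed
qed

lemma poly_bounded_diff:
  "poly_bounded \<phi> \<Longrightarrow> poly_bounded \<psi> \<Longrightarrow> poly_bounded (\<lambda>j. \<phi> j - \<psi> j)"
  using poly_bounded_add[OF _ poly_bounded_uminus, of \<phi> \<psi>] by simp

lemma poly_bounded_mult:
  assumes "poly_bounded \<phi>" "poly_bounded \<psi>"
  shows "poly_bounded (\<lambda>j. \<phi> j * \<psi> j)"
proof -
  obtain C k where C: "C \<ge> 0" "\<And>j. \<bar>\<phi> j\<bar> \<le> C * real (Suc j) ^ k" using assms(1) poly_boundedE by blast
  obtain D l where D: "D \<ge> 0" "\<And>j. \<bar>\<psi> j\<bar> \<le> D * real (Suc j) ^ l" using assms(2) poly_boundedE by blast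
  show ?thesis
  proof (rule poly_boundedI[of _ "C * D" "k + l"])
    fix j
    have "\<bar>\<phi> j * \<psi> j\<bar> \<le> (C * real (Suc j) ^ k) * (D * real (Suc j) ^ l)"
      unfolding abs_mult using C D by (intro mult_mono) auto
    then show "\<bar>\<phi> j * \<psi> j\<bar> \<le> (C * D) * real (Suc j) ^ (k + l)" by (simp add: power_add algebra_simps)
  qed
qed

lemma poly_bounded_divide_const: "poly_bounded \<phi> \<Longrightarrow> poly_bounded (\<lambda>j. \<phi> j / c)"
  using poly_bounded_mult[of \<phi> "\<lambda>_. 1 / c"] by (simp add: poly_bounded_const)

lemma poly_bounded_power: "poly_bounded \<phi> \<Longrightarrow> poly_bounded (\<lambda>j. \<phi> j ^ k)"
  by (induction k) (auto intro: poly_bounded_mult poly_bounded_const)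

lemma poly_bounded_Suc:
  assumes "poly_bounded \<phi>"
  shows "poly_bounded (\<lambda>j. \<phi> (Suc j))"
proof -
  obtain C k where C: "C \<ge> 0" "\<And>j. \<bar>\<phi> j\<bar> \<le> C * real (Suc j) ^ k" using assms(1) poly_boundedE by blast
  show ?thesis
  proof (rule poly_boundedI[of _ "C * 2 ^ k" k])
    fix j
    have "\<bar>\<phi> (Suc j)\<bar> \<le> C * real (Suc (Suc j)) ^ k" by (rule C)
    also have "\<dots> \<le> C * (2 * real (Suc j)) ^ k"
      using C(1) by (intro mult_left_mono power_mono) auto
    finally show "\<bar>\<phi> (Suc j)\<bar> \<le> C * 2 ^ k * real (Suc j) ^ k" by (simp add: power_mult_distrib[symmetric] algebra_simps)
  qed
qed

lemma poly_bounded_sum: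
  assumes "poly_bounded \<phi>"
  shows "poly_bounded (\<lambda>m. \<Sum>j<m. \<phi> j)"
proof -
  obtain C k where C: "C \<ge> 0" "\<And>j. \<bar>\<phi> j\<bar> \<le> C * real (Suc j) ^ k" using assms(1) poly_boundedE by blast
  show ?thesis
  proof (rule poly_boundedI[of _ C "Suc k"])
    fix m
    have "\<bar>\<Sum>j<m. \<phi> j\<bar> \<le> (\<Sum>j<m. C * real (Suc m) ^ k)"
    proof (intro order.trans[OF sum_abs] sum_mono)
      fix j assume "j \<in> {..<m}"
      then have "C * real (Suc j) ^ k \<le> C * real (Suc m) ^ k"
        using C(1) by (intro mult_left_mono power_mono) auto
      with C(2)[of j] show "\<bar>\<phi> j\<bar> \<le> C * real (Suc m) ^ k" by linarith
    qed
    also have "\<dots> = real m * (C * real (Suc m) ^ k)" by simp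
    also have "\<dots> \<le> real (Suc m) * (C * real (Suc m) ^ k)"
      using C(1) by (intro mult_right_mono) auto
    finally show "\<bar>\<Sum>j<m. \<phi> j\<bar> \<le> C * real (Suc m) ^ Suc k" by (simp add: algebra_simps)
  qed
qed

lemma poly_bounded_powr:
  assumes "poly_bounded \<phi>" "\<And>j. \<phi> j \<ge> 0" "\<gamma> \<ge> 0"
  shows "poly_bounded (\<lambda>j. \<phi> j powr \<gamma>)"
proof -
  obtain K where K: "real K \<ge> \<gamma>" using real_arch_simple by blast
  have "poly_bounded (\<lambda>j. (1 + \<phi> j) ^ K)"
    by (intro poly_bounded_power poly_bounded_add poly_bounded_const assms)
  then show ?thesis
  proof (rule poly_bounded_mono)
    fix j
    have "\<phi> j powr \<gamma> \<le> (1 + \<phi> j) powr \<gamma>" using assms by (intro powr_mono2) auto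
    also have "\<dots> \<le> (1 + \<phi> j) powr real K" using assms K by (intro powr_mono) auto
    also have "\<dots> = (1 + \<phi> j) ^ K" using assms(2)[of j] by (intro powr_realpow) linarith
    finally show "\<bar>\<phi> j powr \<gamma>\<bar> \<le> \<bar>(1 + \<phi> j) ^ K\<bar>" by simp
  qed
qed

lemma bounded_imp_poly_bounded:
  assumes "bounded (range \<phi>)" shows "poly_bounded \<phi>"
  using assms poly_boundedI[of \<phi> _ 0] by (auto simp: bounded_iff)

lemmas poly_bounded_intros =
  poly_bounded_const poly_bounded_of_nat poly_bounded_abs poly_bounded_uminus poly_bounded_add
  poly_bounded_diff poly_bounded_mult poly_bounded_divide_const poly_bounded_power
  poly_bounded_powr poly_bounded_sum

lemma poly_bounded_of_powr_asymp:
  assumes u: "(\<lambda>j. u j / real j powr \<alpha>) \<longlonglongrightarrow> 1" and \<alpha>: "\<alpha> > 0"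
  shows "poly_bounded u"
proof -
  have "poly_bounded (\<lambda>j. u j / real j powr \<alpha>)"
    using u by (intro bounded_imp_poly_bounded convergent_imp_bounded)
  then have "poly_bounded (\<lambda>j. \<bar>u j / real j powr \<alpha>\<bar> * real j powr \<alpha> + \<bar>u 0\<bar>)"
    using \<alpha> by (intro poly_bounded_intros) auto
  then show ?thesis
  proof (rule poly_bounded_mono)
    fix j
    show "\<bar>u j\<bar> \<le> \<bar>\<bar>u j / real j powr \<alpha>\<bar> * real j powr \<alpha> + \<bar>u 0\<bar>\<bar>"
      by (cases "j = 0") auto
  qed
qed

lemma summable_poly_geometric: "summable (\<lambda>j. real (Suc j) ^ k * (1 / 2) ^ j)"
proof (rule summable_comparison_test_ev)
  have "(\<lambda>j. real (Suc j) ^ k * (3 / 4) ^ j) \<longlonglongrightarrow> 0" 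
    by real_asymp
  then have "eventually (\<lambda>j. real (Suc j) ^ k * (3 / 4) ^ j < 1) sequentially"
    by (rule order_tendstoD) auto
  then show "eventually (\<lambda>j. norm (real (Suc j) ^ k * (1 / 2) ^ j) \<le> (2 / 3) ^ j) sequentially"
  proof eventually_elim
    case (elim j)
    have "(1 / 2 :: real) ^ j = (3 / 4) ^ j * (2 / 3) ^ j" by (simp add: power_mult_distrib[symmetric])
    then have "real (Suc j) ^ k * (1 / 2) ^ j = (real (Suc j) ^ k * (3 / 4) ^ j) * (2 / 3) ^ j" by simp
    also have "\<dots> \<le> 1 * (2 / 3) ^ j" using elim by (intro mult_right_mono) auto
    finally show ?case by simp
  qed
  show "summable (\<lambda>j. (2 / 3 :: real) ^ j)" by (rule summable_geometric) simp
qed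

lemma integrable_pmf_nat:
  fixes p :: "nat pmf"
  assumes p: "\<And>j. pmf p j \<le> C * (1 / 2) ^ j" and \<phi>: "poly_bounded \<phi>"
  shows "integrable (measure_pmf p) \<phi>" "(\<lambda>j. pmf p j * \<phi> j) sums measure_pmf.expectation p \<phi>"
proof -
  obtain D k where D: "D \<ge> 0" "\<And>j. \<bar>\<phi> j\<bar> \<le> D * real (Suc j) ^ k" using \<phi> poly_boundedE by blast
  have "summable (\<lambda>j. norm (pmf p j * \<phi> j))"
  proof (rule summable_comparison_test')
    show "summable (\<lambda>j. C * D * (real (Suc j) ^ k * (1 / 2) ^ j))"
      by (intro summable_mult summable_poly_geometric)
    fix j :: nat
    have "pmf p j * \<bar>\<phi> j\<bar> \<le> (C * (1 / 2) ^ j) * (D * real (Suc j) ^ k)"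
      using p[of j] D by (intro mult_mono) (auto intro: order.trans[OF pmf_nonneg])
    then show "norm (norm (pmf p j * \<phi> j)) \<le> C * D * (real (Suc j) ^ k * (1 / 2) ^ j)"
      by (simp add: abs_mult algebra_simps)
  qed
  then have int: "integrable (count_space UNIV) (\<lambda>j. pmf p j * \<phi> j)"
    by (simp add: integrable_count_space_nat_iff)
  then show "integrable (measure_pmf p) \<phi>"
    unfolding measure_pmf_eq_density by (subst integrable_density) auto
  have "measure_pmf.expectation p \<phi> = integral\<^sup>L (count_space UNIV) (\<lambda>j. pmf p j * \<phi> j)"
    unfolding measure_pmf_eq_density by (subst integral_density) auto
  with sums_integral_count_space_nat[OF int]
  show "(\<lambda>j. pmf p j * \<phi> j) sums measure_pmf.expectation p \<phi>" by simp
qed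

section \<open>The law of the number of red balls at a blue draw\<close>

text \<open>
  The law \<open>P n\<close> of the number of red balls at the \<open>n\<close>-th blue draw, described only by the balance
  equation. Multiplying out \<open>1 + \<beta> n / \<rho> j\<close> shows an implicit Euler step of length \<open>\<beta> n\<close> for the
  forward equation of the pure birth process with rates \<open>1 / \<rho> j\<close>.
\<close>
locale red_count_law =
  fixes \<beta> \<rho> :: "nat \<Rightarrow> real" and P :: "nat \<Rightarrow> nat pmf"
  assumes \<beta>_pos: "\<beta> n > 0" and \<rho>_pos: "\<rho> j > 0"
    and \<rho>_top: "filterlim \<rho> at_top sequentially"
    and \<rho>_poly: "poly_bounded \<rho>"
    and initial: "P 0 = return_pmf 0"
    and balance: "pmf (P (Suc n)) j * (1 + \<beta> n / \<rho> j) =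
      pmf (P n) j + (if j = 0 then 0 else pmf (P (Suc n)) (j - 1) * (\<beta> n / \<rho> (j - 1)))"
begin

abbreviation E :: "nat \<Rightarrow> (nat \<Rightarrow> real) \<Rightarrow> real" where
  "E n \<phi> \<equiv> measure_pmf.expectation (P n) \<phi>"

text \<open>
  Since \<open>\<rho>\<close> tends to infinity, the flux into \<open>j + 1\<close> is eventually at most a quarter of the mass at \<open>j\<close>;
  so a geometric bound with ratio \<open>1 / 2\<close> is passed on from \<open>n\<close> to \<open>n + 1\<close>, with a larger constant.
\<close>
lemma geometric_tail: "\<exists>C\<ge>0. \<forall>j. pmf (P n) j \<le> C * (1 / 2) ^ j"
proof (induction n)
  case 0
  show ?case by (rule exI[of _ 1]) (auto simp: initial indicator_def)
next
  case (Suc n)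
  then obtain C where C: "C \<ge> 0" "\<And>j. pmf (P n) j \<le> C * (1 / 2) ^ j" by blast
  have "eventually (\<lambda>j. \<rho> j \<ge> 4 * \<beta> n) sequentially"
    using \<rho>_top by (simp add: filterlim_at_top)
  then obtain J where J: "\<And>j. j \<ge> J \<Longrightarrow> \<rho> j \<ge> 4 * \<beta> n"
    by (auto simp: eventually_at_top_linorder)
  define D where "D = 2 * C + 2 ^ J"
  have D: "D \<ge> 2 * C" "D \<ge> 2 ^ J" "D \<ge> 0" using C(1) by (auto simp: D_def)
  have "pmf (P (Suc n)) j \<le> D * (1 / 2) ^ j" for j
  proof (induction j)
    case 0
    have "pmf (P (Suc n)) 0 \<le> 1" by (rule pmf_le_1)
    also have "(1::real) \<le> 2 ^ J" by simp
    finally show ?case using D by simp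
  next
    case (Suc j)
    show ?case
    proof (cases "j < J")
      case True
      have "pmf (P (Suc n)) (Suc j) \<le> 1" by (rule pmf_le_1)
      also have "(1 :: real) = 2 ^ Suc j * (1 / 2) ^ Suc j" by (simp add: power_mult_distrib[symmetric])
      also have "\<dots> \<le> 2 ^ J * (1 / 2) ^ Suc j"
        using True by (intro mult_right_mono power_increasing) auto
      also have "\<dots> \<le> D * (1 / 2) ^ Suc j" using D by (intro mult_right_mono) auto
      finally show ?thesis .
    next
      case False
      have q: "\<beta> n / \<rho> j \<le> 1 / 4" using J[of j] False \<rho>_pos[of j] by (simp add: field_simps)
      have "pmf (P (Suc n)) (Suc j) \<le> pmf (P (Suc n)) (Suc j) * (1 + \<beta> n / \<rho> (Suc j))"
        using \<beta>_pos[of n] \<rho>_pos[of "Suc j"] by (simp add: algebra_simps)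
      also have "\<dots> = pmf (P n) (Suc j) + pmf (P (Suc n)) j * (\<beta> n / \<rho> j)"
        by (subst balance) simp
      also have "\<dots> \<le> C * (1 / 2) ^ Suc j + (D * (1 / 2) ^ j) * (1 / 4)"
        using C(2)[of "Suc j"] q Suc.IH \<beta>_pos[of n] \<rho>_pos[of j] D
        by (intro add_mono mult_mono) (auto intro: less_imp_le)
      also have "\<dots> = (C + D / 2) * (1 / 2) ^ Suc j" by (simp add: algebra_simps)
      also have "\<dots> \<le> D * (1 / 2) ^ Suc j" using D by (intro mult_right_mono) auto
      finally show ?thesis .
    qed
  qed
  with D(3) show ?case by blast
qed

lemma integrable_P [intro]: "poly_bounded \<phi> \<Longrightarrow> integrable (measure_pmf (P n)) \<phi>"
  and sums_E: "poly_bounded \<phi> \<Longrightarrow> (\<lambda>j. pmf (P n) j * \<phi> j) sums E n \<phi>"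
  using geometric_tail[of n] integrable_pmf_nat by blast+

lemma E_0 [simp]: "E 0 \<phi> = \<phi> 0"
  by (simp add: initial)

lemma E_add: "poly_bounded \<phi> \<Longrightarrow> poly_bounded \<psi> \<Longrightarrow> E n (\<lambda>j. \<phi> j + \<psi> j) = E n \<phi> + E n \<psi>"
  by (intro Bochner_Integration.integral_add integrable_P)

lemma E_diff: "poly_bounded \<phi> \<Longrightarrow> poly_bounded \<psi> \<Longrightarrow> E n (\<lambda>j. \<phi> j - \<psi> j) = E n \<phi> - E n \<psi>"
  by (intro Bochner_Integration.integral_diff integrable_P)

lemma E_mono: "poly_bounded \<phi> \<Longrightarrow> poly_bounded \<psi> \<Longrightarrow> (\<And>j. \<phi> j \<le> \<psi> j) \<Longrightarrow> E n \<phi> \<le> E n \<psi>"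
  by (intro integral_mono integrable_P)

lemma poly_bounded_inverse_\<rho>: "poly_bounded (\<lambda>j. 1 / \<rho> j)"
proof -
  have "(\<lambda>j. 1 / \<rho> j) \<longlonglongrightarrow> 0"
    using tendsto_inverse_0_at_top[OF \<rho>_top] by (simp add: inverse_eq_divide)
  then show ?thesis
    by (intro bounded_imp_poly_bounded convergent_imp_bounded)
qed

text \<open>
  The balance equation in weak form: summing it against \<open>\<phi>\<close> and shifting the index in the flux
  term turns that term into a difference quotient of \<open>\<phi>\<close>.
\<close>
lemma E_step:
  assumes \<phi>: "poly_bounded \<phi>"
  shows "E (Suc n) \<phi> = E n \<phi> + \<beta> n * E (Suc n) (\<lambda>j. (\<phi> (Suc j) - \<phi> j) / \<rho> j)"
proof -
  define h where "h j = pmf (P (Suc n)) j * (\<beta> n / \<rho> j)" for j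
  have pb1: "poly_bounded (\<lambda>j. \<phi> j * (1 / \<rho> j))" and pb2: "poly_bounded (\<lambda>j. \<phi> (Suc j) * (1 / \<rho> j))"
    by (intro poly_bounded_mult poly_bounded_Suc \<phi> poly_bounded_inverse_\<rho>)+
  have h1: "(\<lambda>j. h j * \<phi> j) sums (\<beta> n * E (Suc n) (\<lambda>j. \<phi> j * (1 / \<rho> j)))"
    using sums_mult[OF sums_E[OF pb1, of "Suc n"], of "\<beta> n"] by (simp add: h_def algebra_simps)
  have h2: "(\<lambda>j. h j * \<phi> (Suc j)) sums (\<beta> n * E (Suc n) (\<lambda>j. \<phi> (Suc j) * (1 / \<rho> j)))"
    using sums_mult[OF sums_E[OF pb2, of "Suc n"], of "\<beta> n"] by (simp add: h_def algebra_simps)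
  have h3: "(\<lambda>j. if j = 0 then 0 else h (j - 1) * \<phi> j) sums (\<beta> n * E (Suc n) (\<lambda>j. \<phi> (Suc j) * (1 / \<rho> j)))"
    using sums_Suc[of "\<lambda>j. if j = 0 then 0 else h (j - 1) * \<phi> j"] h2 by simp
  have eq: "(\<lambda>j. pmf (P (Suc n)) j * \<phi> j + h j * \<phi> j) = (\<lambda>j. pmf (P n) j * \<phi> j + (if j = 0 then 0 else h (j - 1) * \<phi> j))"
  proof
    fix j
    have "pmf (P (Suc n)) j * \<phi> j + h j * \<phi> j = (pmf (P (Suc n)) j * (1 + \<beta> n / \<rho> j)) * \<phi> j"
      by (simp add: h_def algebra_simps)
    also have "\<dots> = pmf (P n) j * \<phi> j + (if j = 0 then 0 else h (j - 1) * \<phi> j)"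
      by (subst balance) (simp add: h_def algebra_simps)
    finally show "pmf (P (Suc n)) j * \<phi> j + h j * \<phi> j = pmf (P n) j * \<phi> j + (if j = 0 then 0 else h (j - 1) * \<phi> j)" .
  qed
  have "E (Suc n) \<phi> + \<beta> n * E (Suc n) (\<lambda>j. \<phi> j * (1 / \<rho> j)) =
      E n \<phi> + \<beta> n * E (Suc n) (\<lambda>j. \<phi> (Suc j) * (1 / \<rho> j))"
    by (rule sums_unique2[OF sums_add[OF sums_E[OF \<phi>, of "Suc n"] h1, unfolded eq]
          sums_add[OF sums_E[OF \<phi>, of n] h3]])
  moreover have "E (Suc n) (\<lambda>j. (\<phi> (Suc j) - \<phi> j) / \<rho> j) =
      E (Suc n) (\<lambda>j. \<phi> (Suc j) * (1 / \<rho> j)) - E (Suc n) (\<lambda>j. \<phi> j * (1 / \<rho> j))"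
    using E_diff[OF pb2 pb1, of "Suc n"] by (simp add: diff_divide_distrib)
  ultimately show ?thesis by (simp only: right_diff_distrib)
qed

text \<open>
  The recursion step for the coefficients of
  \<open>(\<Prod>i<j. 1 + \<lambda> * \<rho> i) * (\<Prod>i<n. 1 - \<lambda> * \<beta> i)\<close>: for \<open>\<Phi>\<close> the coefficient following \<open>\<Psi>\<close>, the
  contribution of a blue draw to the mean of \<open>\<Phi>\<close> cancels the contribution of the red draws before it as
  soon as the mean of \<open>\<Psi>\<close> is independent of \<open>n\<close>.
\<close>
lemma E_zero_of_constant_mean:
  assumes \<Phi>: "\<And>n. poly_bounded (\<Phi> n)" and \<Psi>: "\<And>n. poly_bounded (\<Psi> n)"
    and blue: "\<And>n j. \<Phi> (Suc n) j = \<Phi> n j - \<beta> n * \<Psi> n j"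
    and red: "\<And>n j. \<Phi> n (Suc j) = \<Phi> n j + \<rho> j * \<Psi> n j"
    and start: "\<Phi> 0 0 = 0" and const: "\<And>n. E n (\<Psi> n) = c"
  shows "E n (\<Phi> n) = 0"
proof (induction n)
  case 0
  show ?case by (simp add: start)
next
  case (Suc n)
  have "E (Suc n) (\<Phi> (Suc n)) = E n (\<Phi> (Suc n)) + \<beta> n * E (Suc n) (\<lambda>j. (\<Phi> (Suc n) (Suc j) - \<Phi> (Suc n) j) / \<rho> j)"
    by (rule E_step[OF \<Phi>])
  also have "(\<lambda>j. (\<Phi> (Suc n) (Suc j) - \<Phi> (Suc n) j) / \<rho> j) = \<Psi> (Suc n)"
    using \<rho>_pos by (intro ext) (simp add: red less_imp_neq[symmetric])
  also have "E n (\<Phi> (Suc n)) = E n (\<Phi> n) - \<beta> n * E n (\<Psi> n)"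
    unfolding blue by (subst E_diff) (simp_all add: \<Phi> \<Psi> poly_bounded_intros)
  finally show ?case using Suc.IH const by simp
qed

section \<open>Exact moment identities\<close>

definition Y :: "nat \<Rightarrow> nat \<Rightarrow> real" where
  "Y n j = (\<Sum>i<j. \<rho> i) - (\<Sum>i<n. \<beta> i)"

definition S :: "nat \<Rightarrow> nat \<Rightarrow> nat \<Rightarrow> real" where
  "S k n j = (\<Sum>i<j. \<rho> i ^ k) + (- 1) ^ k * (\<Sum>i<n. \<beta> i ^ k)"

lemma poly_bounded_Y: "poly_bounded (Y n)"
  unfolding Y_def by (intro poly_bounded_intros \<rho>_poly)

lemma poly_bounded_S: "poly_bounded (S k n)"
  unfolding S_def by (intro poly_bounded_intros \<rho>_poly)

lemma Y_rec: "Y (Suc n) j = Y n j - \<beta> n" "Y n (Suc j) = Y n j + \<rho> j" "Y 0 0 = 0"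
  by (auto simp: Y_def)

lemma S_rec: "S k (Suc n) j = S k n j + (- \<beta> n) ^ k" "S k n (Suc j) = S k n j + \<rho> j ^ k" "S k 0 0 = 0"
  by (auto simp: S_def power_minus[of "\<beta> n"] algebra_simps)

lemmas Y_S_intros = poly_bounded_intros poly_bounded_Y poly_bounded_S

text \<open>
  The polynomials in the next four lemmas are the coefficients of degree one to four of the product
  above, written in power sums by Newton's identities. A red draw adds \<open>t = \<rho> j\<close> and a blue draw
  \<open>t = - \<beta> n\<close> to the list of summands, so a single identity in \<open>t\<close> serves both recursions.
\<close>
lemma E_Y: "E n (Y n) = 0"
  by (rule E_zero_of_constant_mean[where \<Psi> = "\<lambda>_ _. 1" and c = 1])
    (simp_all add: Y_rec poly_bounded_Y poly_bounded_const)

lemma E_Y_power2: "E n (\<lambda>j. (Y n j)\<^sup>2) = E n (S 2 n)"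
proof -
  have "E n (\<lambda>j. ((Y n j)\<^sup>2 - S 2 n j) / 2) = 0"
  proof (rule E_zero_of_constant_mean[where \<Psi> = Y and c = 0])
    show "poly_bounded (\<lambda>j. ((Y n j)\<^sup>2 - S 2 n j) / 2)" for n by (intro Y_S_intros)
  qed (simp_all add: Y_rec S_rec E_Y poly_bounded_Y power2_eq_square field_simps)
  then show ?thesis by (simp add: E_diff Y_S_intros)
qed

lemma E_cubic: "E n (\<lambda>j. (Y n j ^ 3 - 3 * Y n j * S 2 n j + 2 * S 3 n j) / 6) = 0"
proof (rule E_zero_of_constant_mean[where \<Psi> = "\<lambda>n j. ((Y n j)\<^sup>2 - S 2 n j) / 2" and c = 0])
  show "poly_bounded (\<lambda>j. (Y n j ^ 3 - 3 * Y n j * S 2 n j + 2 * S 3 n j) / 6)" for n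
    by (intro Y_S_intros)
  show "poly_bounded (\<lambda>j. ((Y n j)\<^sup>2 - S 2 n j) / 2)" for n by (intro Y_S_intros)
  show "E n (\<lambda>j. ((Y n j)\<^sup>2 - S 2 n j) / 2) = 0" for n
    by (simp add: E_diff Y_S_intros E_Y_power2)
qed (simp_all add: Y_rec S_rec, algebra+)

lemma E_quartic:
  "E n (\<lambda>j. (Y n j ^ 4 - 6 * (Y n j)\<^sup>2 * S 2 n j + 3 * (S 2 n j)\<^sup>2 + 8 * Y n j * S 3 n j - 6 * S 4 n j) / 24) = 0"
proof (rule E_zero_of_constant_mean
      [where \<Psi> = "\<lambda>n j. (Y n j ^ 3 - 3 * Y n j * S 2 n j + 2 * S 3 n j) / 6" and c = 0])
  show "poly_bounded (\<lambda>j. (Y n j ^ 4 - 6 * (Y n j)\<^sup>2 * S 2 n j + 3 * (S 2 n j)\<^sup>2 + 8 * Y n j * S 3 n j - 6 * S 4 n j) / 24)" for n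
    by (intro Y_S_intros)
  show "poly_bounded (\<lambda>j. (Y n j ^ 3 - 3 * Y n j * S 2 n j + 2 * S 3 n j) / 6)" for n
    by (intro Y_S_intros)
  have shift: "((y + t) ^ 4 - 6 * (y + t)\<^sup>2 * (s2 + t\<^sup>2) + 3 * (s2 + t\<^sup>2)\<^sup>2
        + 8 * (y + t) * (s3 + t ^ 3) - 6 * (s4 + t ^ 4)) / 24 =
      (y ^ 4 - 6 * y\<^sup>2 * s2 + 3 * s2\<^sup>2 + 8 * y * s3 - 6 * s4) / 24
        + t * ((y ^ 3 - 3 * y * s2 + 2 * s3) / 6)" for y s2 s3 s4 t :: real
  proof -
    have "(y + t) ^ 4 - 6 * (y + t)\<^sup>2 * (s2 + t\<^sup>2) + 3 * (s2 + t\<^sup>2)\<^sup>2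
        + 8 * (y + t) * (s3 + t ^ 3) - 6 * (s4 + t ^ 4) =
      (y ^ 4 - 6 * y\<^sup>2 * s2 + 3 * s2\<^sup>2 + 8 * y * s3 - 6 * s4) + 4 * (t * (y ^ 3 - 3 * y * s2 + 2 * s3))"
      by algebra
    moreover have "a / 24 = b / 24 + t * (c / 6)" if "a = b + 4 * (t * c)" for a b c :: real
      using that by simp
    ultimately show ?thesis by blast
  qed
  fix n j
  let ?A = "\<lambda>n j. (Y n j ^ 4 - 6 * (Y n j)\<^sup>2 * S 2 n j + 3 * (S 2 n j)\<^sup>2 + 8 * Y n j * S 3 n j - 6 * S 4 n j) / 24"
  let ?B = "\<lambda>n j. (Y n j ^ 3 - 3 * Y n j * S 2 n j + 2 * S 3 n j) / 6"
  show "?A n (Suc j) = ?A n j + \<rho> j * ?B n j"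
    unfolding Y_rec S_rec by (rule shift)
  show "?A (Suc n) j = ?A n j - \<beta> n * ?B n j"
    using shift[of "Y n j" "- \<beta> n" "S 2 n j" "S 3 n j" "S 4 n j"] unfolding Y_rec S_rec by simp
  show "E n (?B n) = 0" by (rule E_cubic)
qed (simp add: Y_rec S_rec)

lemma E_Y_power4:
  "E n (\<lambda>j. Y n j ^ 4) =
     E n (\<lambda>j. 6 * (Y n j)\<^sup>2 * S 2 n j - 3 * (S 2 n j)\<^sup>2 - 8 * Y n j * S 3 n j + 6 * S 4 n j)"
proof -
  have "E n (\<lambda>j. Y n j ^ 4 - (6 * (Y n j)\<^sup>2 * S 2 n j - 3 * (S 2 n j)\<^sup>2 - 8 * Y n j * S 3 n j + 6 * S 4 n j)) = 0"
    using E_quartic[of n] by (simp add: algebra_simps)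
  moreover have "poly_bounded (\<lambda>j. Y n j ^ 4)"
    "poly_bounded (\<lambda>j. 6 * (Y n j)\<^sup>2 * S 2 n j - 3 * (S 2 n j)\<^sup>2 - 8 * Y n j * S 3 n j + 6 * S 4 n j)"
    by (intro Y_S_intros)+
  ultimately show ?thesis by (simp only: E_diff right_minus_eq)
qed

end

section \<open>Moment bounds for power-law waiting times\<close>

locale power_law_waits = red_count_law +
  fixes \<alpha> c c' :: real
  assumes \<alpha>_pos: "\<alpha> > 0"
    and \<rho>_asymp: "(\<lambda>j. (\<rho> j - real j powr \<alpha>) / real j powr (\<alpha> - 1)) \<longlonglongrightarrow> c"
    and \<beta>_asymp: "(\<lambda>i. (\<beta> i - real i powr \<alpha>) / real i powr (\<alpha> - 1)) \<longlonglongrightarrow> c'"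
begin

text \<open>
  \<open>H\<close> is the leading term of the partial sums of \<open>\<rho>\<close> and of \<open>\<beta>\<close>; \<open>F\<close> is \<open>Y\<close> on the scale on which it
  is comparable to \<open>K\<close>, the same quantity with \<open>H\<close> in place of both partial sums. The exact identities
  hold for \<open>F\<close>, while the expansion of \<open>R / n\<close> is in terms of \<open>K\<close>.
\<close>
definition H :: "nat \<Rightarrow> real" where "H m = real m powr (\<alpha> + 1) / (\<alpha> + 1)"
definition F :: "nat \<Rightarrow> nat \<Rightarrow> real" where "F n j = Y n j / real n powr (\<alpha> + 1)"
definition K :: "nat \<Rightarrow> nat \<Rightarrow> real" where
  "K n j = ((real j / real n) powr (\<alpha> + 1) - 1) / (\<alpha> + 1)"

lemma poly_bounded_ratio_powr: "\<gamma> \<ge> 0 \<Longrightarrow> poly_bounded (\<lambda>j. (real j / real n) powr \<gamma>)"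
  by (rule poly_bounded_powr) (auto intro: poly_bounded_intros)

lemma poly_bounded_K: "poly_bounded (K n)"
  unfolding K_def using \<alpha>_pos by (intro poly_bounded_intros poly_bounded_ratio_powr) auto

lemma poly_bounded_F: "poly_bounded (F n)"
  unfolding F_def by (intro poly_bounded_intros poly_bounded_Y)

lemmas FK_intros = poly_bounded_intros poly_bounded_F poly_bounded_K

lemmas sum_\<rho>_asymp = sum_asymp_powr_second_order[OF \<alpha>_pos \<rho>_asymp, folded H_def]
lemmas sum_\<beta>_asymp = sum_asymp_powr_second_order[OF \<alpha>_pos \<beta>_asymp, folded H_def]
lemmas power_sum_\<rho>_asymp = power_sum_asymp[OF first_order_of_second_order[OF \<rho>_asymp] \<alpha>_pos]
lemmas power_sum_\<beta>_asymp = power_sum_asymp[OF first_order_of_second_order[OF \<beta>_asymp] \<alpha>_pos]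

text \<open>
  The partial sums differ from \<open>H\<close> by at most a constant times \<open>m powr \<alpha>\<close>, which for
  \<open>m = n\<close> is a factor \<open>n\<close> below the normalisation, and \<open>x powr \<alpha>\<close> is bounded by a multiple of \<open>1 + \<bar>K\<bar>\<close>.
\<close>
lemma F_near_K: "\<exists>C\<ge>0. \<forall>n\<ge>1. \<forall>j. \<bar>F n j - K n j\<bar> \<le> C * (1 + \<bar>K n j\<bar>) / real n"
proof -
  obtain A where A: "\<And>m. \<bar>(\<Sum>i<m. \<rho> i) - H m\<bar> \<le> A * real m powr \<alpha>"
    using bound_of_powr_asymp[OF sum_\<rho>_asymp] \<alpha>_pos by (auto simp: H_def)
  obtain B where B: "\<And>m. \<bar>(\<Sum>i<m. \<beta> i) - H m\<bar> \<le> B * real m powr \<alpha>"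
    using bound_of_powr_asymp[OF sum_\<beta>_asymp] \<alpha>_pos by (auto simp: H_def)
  have AB: "A \<ge> 0" "B \<ge> 0" using A[of 1] B[of 1] by auto
  have "\<bar>F n j - K n j\<bar> \<le> (A + B) * (\<alpha> + 2) * (1 + \<bar>K n j\<bar>) / real n" if n: "n \<ge> 1" for n j
  proof -
    define x where "x = real j / real n"
    have x: "x \<ge> 0" "real j = x * real n" using n by (auto simp: x_def)
    have pos: "real n powr (\<alpha> + 1) > 0" "real n powr \<alpha> > 0" using n by auto
    have np: "real n powr (\<alpha> + 1) = real n * real n powr \<alpha>" using n by (simp add: powr_add)
    have HK: "H j - H n = real n powr (\<alpha> + 1) * K n j"
      unfolding H_def K_def x_def[symmetric] unfolding x(2) using x \<alpha>_pos
      by (simp add: powr_mult diff_divide_distrib[symmetric] right_diff_distrib mult.commute)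
    have "F n j - K n j = (Y n j - (H j - H n)) / real n powr (\<alpha> + 1)"
      unfolding HK F_def using pos by (simp add: field_simps)
    also have "\<bar>\<dots>\<bar> = \<bar>((\<Sum>i<j. \<rho> i) - H j) - ((\<Sum>i<n. \<beta> i) - H n)\<bar> / real n powr (\<alpha> + 1)"
      by (simp add: Y_def abs_divide algebra_simps)
    also have "\<dots> \<le> (A * real j powr \<alpha> + B * real n powr \<alpha>) / real n powr (\<alpha> + 1)"
      using A[of j] B[of n] by (intro divide_right_mono) auto
    also have "\<dots> = (A * x powr \<alpha> + B) / real n"
      unfolding x(2) np using x pos n by (simp add: powr_mult field_simps)
    also have "\<dots> \<le> ((A + B) * (\<alpha> + 2) * (1 + \<bar>K n j\<bar>)) / real n"
    proof (intro divide_right_mono)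
      have "\<bar>x powr \<alpha> - 1\<bar> \<le> (\<alpha> + 1) * \<bar>K n j\<bar>"
        using abs_powr_minus_one_mono[of x \<alpha> "\<alpha> + 1"] x(1) \<alpha>_pos by (simp add: K_def x_def)
      also have "\<dots> \<le> (\<alpha> + 1) * \<bar>K n j\<bar> + \<bar>K n j\<bar> + (\<alpha> + 1)" using \<alpha>_pos by simp
      finally have "x powr \<alpha> \<le> (\<alpha> + 2) * (1 + \<bar>K n j\<bar>)" by (simp add: algebra_simps)
      moreover have "1 \<le> (\<alpha> + 2) * (1 + \<bar>K n j\<bar>)"
        using mult_mono[of 1 "\<alpha> + 2" 1 "1 + \<bar>K n j\<bar>"] \<alpha>_pos by simp
      ultimately have "A * x powr \<alpha> + B * 1 \<le> A * ((\<alpha> + 2) * (1 + \<bar>K n j\<bar>)) + B * ((\<alpha> + 2) * (1 + \<bar>K n j\<bar>))"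
        using AB by (intro add_mono mult_left_mono) auto
      then show "A * x powr \<alpha> + B \<le> (A + B) * (\<alpha> + 2) * (1 + \<bar>K n j\<bar>)"
        by (simp add: algebra_simps)
    qed auto
    finally show ?thesis .
  qed
  then show ?thesis using AB \<alpha>_pos by (intro exI[of _ "(A + B) * (\<alpha> + 2)"]) auto
qed

lemma K_near_F: "\<exists>C\<ge>0. eventually (\<lambda>n. \<forall>j. \<bar>F n j - K n j\<bar> \<le> C * (1 + \<bar>F n j\<bar>) / real n
    \<and> \<bar>K n j\<bar> \<le> 2 * \<bar>F n j\<bar> + 1) sequentially"
proof -
  obtain C where C: "C \<ge> 0" "\<And>n j. n \<ge> 1 \<Longrightarrow> \<bar>F n j - K n j\<bar> \<le> C * (1 + \<bar>K n j\<bar>) / real n"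
    using F_near_K by blast
  obtain N :: nat where N: "real N \<ge> 2 * C" using real_arch_simple by blast
  have "\<bar>F n j - K n j\<bar> \<le> (2 * C) * (1 + \<bar>F n j\<bar>) / real n \<and> \<bar>K n j\<bar> \<le> 2 * \<bar>F n j\<bar> + 1" 
    if n: "n \<ge> max 1 N" for n j
  proof -
    have "2 * C \<le> real n" using n N by (meson le_max_iff_disj max.bounded_iff of_nat_le_iff order.trans)
    then have "C / real n \<le> 1 / 2" using n by (simp add: field_simps)
    then have "C / real n * (1 + \<bar>K n j\<bar>) \<le> 1 / 2 * (1 + \<bar>K n j\<bar>)" by (intro mult_right_mono) auto
    then have "C * (1 + \<bar>K n j\<bar>) / real n \<le> 1 / 2 * (1 + \<bar>K n j\<bar>)" by simp
    moreover have "\<bar>F n j - K n j\<bar> \<le> C * (1 + \<bar>K n j\<bar>) / real n" using n by (intro C) simp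
    ultimately have "\<bar>F n j - K n j\<bar> \<le> 1 / 2 * (1 + \<bar>K n j\<bar>)" by linarith
    then have *: "\<bar>K n j\<bar> \<le> 2 * \<bar>F n j\<bar> + 1" by (auto simp: abs_if split: if_splits)
    have "C * (1 + \<bar>K n j\<bar>) / real n \<le> C * (2 + 2 * \<bar>F n j\<bar>) / real n"
      using * C(1) by (intro divide_right_mono mult_left_mono) auto
    with C(2)[of n j] n * show ?thesis by (simp add: algebra_simps)
  qed
  then show ?thesis using C(1)
    by (intro exI[of _ "2 * C"] conjI eventually_sequentiallyI[of "max 1 N"]) auto
qed

text \<open>
  The power sums grow like \<open>m powr (k * \<alpha> + 1)\<close>, hence are smaller by the factor \<open>n ^ (k - 1)\<close> than the
  \<open>k\<close>-th power of the scale of \<open>Y\<close>. Bounding the part that depends on \<open>j\<close> by \<open>F\<close> makes the estimate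
  uniform in \<open>j\<close>, and hence usable for red counts far larger than \<open>n\<close>.
\<close>
lemma S_bound:
  assumes k: "k \<ge> 1"
  shows "\<exists>C\<ge>0. eventually (\<lambda>n. \<forall>j. \<bar>S k n j\<bar> / (real n powr (\<alpha> + 1)) ^ k
    \<le> C * (1 + \<bar>F n j\<bar> ^ k) / real n ^ (k - 1)) sequentially"
proof -
  define \<gamma> where "\<gamma> = real k * \<alpha> + 1"
  have \<gamma>: "0 \<le> \<gamma>" "\<gamma> \<le> real k * (\<alpha> + 1)" using k \<alpha>_pos by (auto simp: \<gamma>_def algebra_simps)
  obtain A where A: "\<And>m. \<bar>\<Sum>i<m. \<rho> i ^ k\<bar> \<le> A * real m powr \<gamma>"
    using bound_of_powr_asymp[OF power_sum_\<rho>_asymp[of k]] by (auto simp: \<gamma>_def)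
  obtain B where B: "\<And>m. \<bar>\<Sum>i<m. \<beta> i ^ k\<bar> \<le> B * real m powr \<gamma>"
    using bound_of_powr_asymp[OF power_sum_\<beta>_asymp[of k]] by (auto simp: \<gamma>_def)
  have AB: "A \<ge> 0" "B \<ge> 0" using A[of 1] B[of 1] by auto
  define D where "D = 2 * (\<alpha> + 1) + 1"
  have D: "D \<ge> 1" using \<alpha>_pos by (simp add: D_def)
  define C where "C = (A + B) * (1 + D ^ k * 2 ^ k)"
  obtain C0 where "eventually (\<lambda>n. \<forall>j. \<bar>F n j - K n j\<bar> \<le> C0 * (1 + \<bar>F n j\<bar>) / real n
    \<and> \<bar>K n j\<bar> \<le> 2 * \<bar>F n j\<bar> + 1) sequentially" using K_near_F by blast
  then have "eventually (\<lambda>n. \<forall>j. \<bar>S k n j\<bar> / (real n powr (\<alpha> + 1)) ^ k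
    \<le> C * (1 + \<bar>F n j\<bar> ^ k) / real n ^ (k - 1)) sequentially"
    using eventually_gt_at_top[of 0]
  proof (eventually_elim, intro allI)
    fix n j :: nat
    assume KF: "\<forall>j. \<bar>F n j - K n j\<bar> \<le> C0 * (1 + \<bar>F n j\<bar>) / real n \<and> \<bar>K n j\<bar> \<le> 2 * \<bar>F n j\<bar> + 1"
      and n: "n > 0"
    define x where "x = real j / real n"
    have x: "x \<ge> 0" "real j = x * real n" using n by (auto simp: x_def)
    have pos: "real n powr (\<alpha> + 1) > 0" "real n powr \<gamma> > 0" using n by auto
    have np: "(real n powr (\<alpha> + 1)) ^ k = real n powr \<gamma> * real n ^ (k - 1)"
    proof -
      have "(real n powr (\<alpha> + 1)) ^ k = real n powr ((\<alpha> + 1) * real k)"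
        using n by (simp add: powr_powr[symmetric] powr_realpow)
      also have "(\<alpha> + 1) * real k = \<gamma> + real (k - 1)" using k by (simp add: \<gamma>_def algebra_simps of_nat_diff)
      finally show ?thesis using n by (simp add: powr_add powr_realpow)
    qed
    have "\<bar>S k n j\<bar> \<le> \<bar>\<Sum>i<j. \<rho> i ^ k\<bar> + \<bar>\<Sum>i<n. \<beta> i ^ k\<bar>"
      unfolding S_def by (rule order.trans[OF abs_triangle_ineq]) (simp add: abs_mult power_abs)
    also have "\<dots> \<le> A * real j powr \<gamma> + B * real n powr \<gamma>"
      using A[of j] B[of n] by simp
    also have "\<dots> = (A * x powr \<gamma> + B) * real n powr \<gamma>"
      unfolding x(2) using x pos n by (simp add: powr_mult field_simps)
    finally have "\<bar>S k n j\<bar> / (real n powr (\<alpha> + 1)) ^ k \<le> (A * x powr \<gamma> + B) * real n powr \<gamma> / (real n powr (\<alpha> + 1)) ^ k"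
      using pos by (intro divide_right_mono) auto
    also have "\<dots> = (A * x powr \<gamma> + B) / real n ^ (k - 1)"
      unfolding np using pos by simp
    also have "\<dots> \<le> C * (1 + \<bar>F n j\<bar> ^ k) / real n ^ (k - 1)"
    proof (intro divide_right_mono)
      have "x powr (\<alpha> + 1) = 1 + (\<alpha> + 1) * K n j" using \<alpha>_pos by (simp add: K_def x_def)
      also have "\<dots> \<le> 1 + (\<alpha> + 1) * (2 * \<bar>F n j\<bar> + 1)"
        using KF \<alpha>_pos by (intro add_left_mono mult_left_mono) (auto intro: order.trans[OF abs_ge_self])
      also have "\<dots> \<le> D * (1 + \<bar>F n j\<bar>)" using \<alpha>_pos by (simp add: D_def algebra_simps)
      finally have "(x powr (\<alpha> + 1)) ^ k \<le> (D * (1 + \<bar>F n j\<bar>)) ^ k" by (intro power_mono) auto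
      also have "\<dots> \<le> D ^ k * (2 ^ k * (1 + \<bar>F n j\<bar> ^ k))"
        unfolding power_mult_distrib using D by (intro mult_left_mono one_plus_power_le) auto
      finally have "x powr \<gamma> \<le> 1 + D ^ k * (2 ^ k * (1 + \<bar>F n j\<bar> ^ k))"
        using powr_le_one_plus_power[OF x(1) \<gamma>] by linarith
      then have *: "x powr \<gamma> \<le> (1 + D ^ k * 2 ^ k) * (1 + \<bar>F n j\<bar> ^ k)" 
        by (simp add: algebra_simps) (smt (verit) zero_le_power abs_ge_zero)
      have "1 \<le> (1 + D ^ k * 2 ^ k) * (1 + \<bar>F n j\<bar> ^ k)"
        using mult_mono[of 1 "1 + D ^ k * 2 ^ k" 1 "1 + \<bar>F n j\<bar> ^ k"] D by simp
      with * have "A * x powr \<gamma> + B * 1 \<le> A * ((1 + D ^ k * 2 ^ k) * (1 + \<bar>F n j\<bar> ^ k)) + B * ((1 + D ^ k * 2 ^ k) * (1 + \<bar>F n j\<bar> ^ k))"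
        using AB by (intro add_mono mult_left_mono) auto
      then show "A * x powr \<gamma> + B \<le> C * (1 + \<bar>F n j\<bar> ^ k)" by (simp add: C_def algebra_simps)
    qed auto
    finally show "\<bar>S k n j\<bar> / (real n powr (\<alpha> + 1)) ^ k \<le> C * (1 + \<bar>F n j\<bar> ^ k) / real n ^ (k - 1)" .
  qed
  moreover have "C \<ge> 0" using AB D by (simp add: C_def)
  ultimately show ?thesis by blast
qed

text \<open>
  Both bounds come from the exact identities by absorption: the right-hand sides contain the moment to
  be bounded, but with a factor of order \<open>1 / n\<close>.
\<close>
lemma F_moments: "\<exists>C. eventually (\<lambda>n. E n (\<lambda>j. (F n j)\<^sup>2) \<le> C / real n \<and>
  E n (\<lambda>j. F n j ^ 4) \<le> C / (real n)\<^sup>2) sequentially"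
proof -
  obtain C2 where C2: "C2 \<ge> 0" "eventually (\<lambda>n. \<forall>j. \<bar>S 2 n j\<bar> / (real n powr (\<alpha> + 1)) ^ 2
    \<le> C2 * (1 + \<bar>F n j\<bar> ^ 2) / real n ^ (2 - 1)) sequentially" using S_bound[of 2] by auto
  obtain C3 where C3: "C3 \<ge> 0" "eventually (\<lambda>n. \<forall>j. \<bar>S 3 n j\<bar> / (real n powr (\<alpha> + 1)) ^ 3
    \<le> C3 * (1 + \<bar>F n j\<bar> ^ 3) / real n ^ (3 - 1)) sequentially" using S_bound[of 3] by auto
  obtain C4 where C4: "C4 \<ge> 0" "eventually (\<lambda>n. \<forall>j. \<bar>S 4 n j\<bar> / (real n powr (\<alpha> + 1)) ^ 4
    \<le> C4 * (1 + \<bar>F n j\<bar> ^ 4) / real n ^ (4 - 1)) sequentially" using S_bound[of 4] by auto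
  define C where "C = C2 + C3 + C4"
  have C: "C \<ge> 0" "C2 \<le> C" "C3 \<le> C" "C4 \<le> C" using C2 C3 C4 by (auto simp: C_def)
  \<comment> \<open>With this lower bound on \<open>n\<close> the coefficient \<open>20 * C / n\<close> of the fourth moment in
    \<open>quartic_pointwise_bound\<close> is at most \<open>1 / 2\<close>.\<close>
  obtain N :: nat where N: "real N \<ge> 40 * C" using real_arch_simple by blast
  have "eventually (\<lambda>n. E n (\<lambda>j. (F n j)\<^sup>2) \<le> (56 * C\<^sup>2 + 28 * C) / real n \<and>
    E n (\<lambda>j. F n j ^ 4) \<le> (56 * C\<^sup>2 + 28 * C) / (real n)\<^sup>2) sequentially"
    using C2(2) C3(2) C4(2) eventually_ge_at_top[of 1] eventually_ge_at_top[of N]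
  proof eventually_elim
    case (elim n)
    define \<delta> where "\<delta> = 1 / real n"
    have \<delta>: "0 < \<delta>" "\<delta> \<le> 1" using elim(4) by (auto simp: \<delta>_def)
    have "40 * C \<le> real n" using N elim(5) by linarith
    then have C\<delta>: "40 * (C * \<delta>) \<le> 1" using elim(4) by (simp add: \<delta>_def field_simps)
    define a where "a = real n powr (\<alpha> + 1)"
    have a: "a > 0" using elim(4) by (simp add: a_def)
    define s where "s k j = S k n j / a ^ k" for k j
    have pb_s: "poly_bounded (s k)" for k unfolding s_def by (intro poly_bounded_intros poly_bounded_S)
    note intros = FK_intros pb_s
    have FY: "F n j = Y n j / a" for j by (simp add: F_def a_def)
    have s2: "\<bar>s 2 j\<bar> \<le> C * (1 + \<bar>F n j\<bar> ^ 2) * \<delta>" for j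
    proof -
      have "\<bar>s 2 j\<bar> \<le> C2 * (1 + \<bar>F n j\<bar> ^ 2) * \<delta>" using elim(1) a by (simp add: s_def \<delta>_def a_def abs_divide)
      also have "\<dots> \<le> C * (1 + \<bar>F n j\<bar> ^ 2) * \<delta>" using C \<delta> by (intro mult_right_mono) auto
      finally show ?thesis .
    qed
    have s3: "\<bar>s 3 j\<bar> \<le> C * (1 + \<bar>F n j\<bar> ^ 3) * \<delta>\<^sup>2" for j
    proof -
      have "\<bar>s 3 j\<bar> \<le> C3 * (1 + \<bar>F n j\<bar> ^ 3) * \<delta>\<^sup>2" using elim(2) a by (simp add: s_def \<delta>_def a_def abs_divide power_divide)
      also have "\<dots> \<le> C * (1 + \<bar>F n j\<bar> ^ 3) * \<delta>\<^sup>2" using C \<delta> by (intro mult_right_mono) auto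
      finally show ?thesis .
    qed
    have s4: "\<bar>s 4 j\<bar> \<le> C * (1 + \<bar>F n j\<bar> ^ 4) * \<delta> ^ 3" for j
    proof -
      have "\<bar>s 4 j\<bar> \<le> C4 * (1 + \<bar>F n j\<bar> ^ 4) * \<delta> ^ 3" using elim(3) a by (simp add: s_def \<delta>_def a_def abs_divide power_divide)
      also have "\<dots> \<le> C * (1 + \<bar>F n j\<bar> ^ 4) * \<delta> ^ 3" using C \<delta> by (intro mult_right_mono) auto
      finally show ?thesis .
    qed
    define m2 where "m2 = E n (\<lambda>j. (F n j)\<^sup>2)"
    define m4 where "m4 = E n (\<lambda>j. F n j ^ 4)"
    have m2_nonneg: "m2 \<ge> 0" and m4_nonneg: "m4 \<ge> 0" unfolding m2_def m4_def by simp_all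
    have "m2 = E n (\<lambda>j. (Y n j)\<^sup>2) / a\<^sup>2" unfolding m2_def FY by (simp add: power_divide)
    also have "\<dots> = E n (s 2)" unfolding E_Y_power2 s_def by simp
    also have "\<dots> \<le> E n (\<lambda>j. C * \<delta> + C * \<delta> * (F n j)\<^sup>2)"
      by (intro E_mono intros) (use s2 in \<open>auto simp: algebra_simps intro: order.trans[OF abs_ge_self]\<close>)
    also have "\<dots> = C * \<delta> + C * \<delta> * m2"
      unfolding m2_def by (subst E_add) (auto intro!: intros)
    finally have "m2 \<le> C * \<delta> + C * \<delta> * m2" .
    moreover have "40 * (C * \<delta>) * m2 \<le> 1 * m2" using C\<delta> m2_nonneg by (intro mult_right_mono) auto
    moreover have "0 \<le> C * \<delta>" using C \<delta> by simp
    ultimately have m2: "m2 \<le> 2 * C * \<delta>" by linarith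
    have "m4 = E n (\<lambda>j. Y n j ^ 4) / a ^ 4" unfolding m4_def FY by (simp add: power_divide)
    also have "\<dots> = E n (\<lambda>j. (6 * (Y n j)\<^sup>2 * S 2 n j - 3 * (S 2 n j)\<^sup>2 - 8 * Y n j * S 3 n j + 6 * S 4 n j) / a ^ 4)"
      unfolding E_Y_power4 by simp
    also have "(\<lambda>j. (6 * (Y n j)\<^sup>2 * S 2 n j - 3 * (S 2 n j)\<^sup>2 - 8 * Y n j * S 3 n j + 6 * S 4 n j) / a ^ 4) =
        (\<lambda>j. 6 * (F n j)\<^sup>2 * s 2 j - 3 * (s 2 j)\<^sup>2 - 8 * F n j * s 3 j + 6 * s 4 j)"
      using a by (intro ext) (simp add: FY s_def power_divide field_simps power2_eq_square power3_eq_cube power4_eq_xxxx)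
    also have "E n \<dots> \<le> E n (\<lambda>j. C * (14 * \<delta> * (F n j)\<^sup>2 + 20 * \<delta> * F n j ^ 4 + 14 * \<delta> ^ 3))"
      using \<delta> by (intro E_mono intros quartic_pointwise_bound C s2 s3 s4) auto
    also have "\<dots> = C * (14 * \<delta> * m2 + 20 * \<delta> * m4 + 14 * \<delta> ^ 3)"
      unfolding m2_def m4_def by (simp add: E_add intros)
    finally have "m4 \<le> 14 * (C * \<delta>) * m2 + 20 * (C * \<delta>) * m4 + 14 * C * \<delta> ^ 3" by (simp add: algebra_simps)
    moreover have "40 * (C * \<delta>) * m4 \<le> 1 * m4" using C\<delta> m4_nonneg by (intro mult_right_mono) auto
    ultimately have "m4 \<le> 28 * (C * \<delta>) * m2 + 28 * C * \<delta> ^ 3" by linarith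
    also have "\<dots> \<le> 28 * (C * \<delta>) * (2 * C * \<delta>) + 28 * C * \<delta>\<^sup>2"
      using m2 C \<delta> by (intro add_mono mult_left_mono power_decreasing) auto
    also have "\<dots> = (56 * C\<^sup>2 + 28 * C) * \<delta>\<^sup>2" by algebra
    finally have m4: "m4 \<le> (56 * C\<^sup>2 + 28 * C) * \<delta>\<^sup>2" .
    have "m2 \<le> (56 * C\<^sup>2 + 28 * C) * \<delta>" 
      using C \<delta> by (intro order.trans[OF m2] mult_right_mono) auto
    with m4 show ?case unfolding m2_def m4_def by (simp add: \<delta>_def power_divide)
  qed
  then show ?thesis by blast
qed

lemma F_power2_tendsto_0: "(\<lambda>n. E n (\<lambda>j. (F n j)\<^sup>2)) \<longlonglongrightarrow> 0"
  and F_power4_tendsto_0: "(\<lambda>n. real n * E n (\<lambda>j. F n j ^ 4)) \<longlonglongrightarrow> 0"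
  and F_abs_tendsto_0: "(\<lambda>n. E n (\<lambda>j. \<bar>F n j\<bar>)) \<longlonglongrightarrow> 0"
proof -
  obtain C where C: "eventually (\<lambda>n. E n (\<lambda>j. (F n j)\<^sup>2) \<le> C / real n \<and>
    E n (\<lambda>j. F n j ^ 4) \<le> C / (real n)\<^sup>2) sequentially" using F_moments by blast
  show "(\<lambda>n. E n (\<lambda>j. (F n j)\<^sup>2)) \<longlonglongrightarrow> 0"
  proof (rule tendsto_sandwich)
    show "(\<lambda>n. 0 :: real) \<longlonglongrightarrow> 0" by simp
    show "(\<lambda>n. C / real n) \<longlonglongrightarrow> 0" by real_asymp
    show "eventually (\<lambda>n. E n (\<lambda>j. (F n j)\<^sup>2) \<le> C / real n) sequentially"
      using C by eventually_elim auto
  qed simp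
  show "(\<lambda>n. real n * E n (\<lambda>j. F n j ^ 4)) \<longlonglongrightarrow> 0"
  proof (rule tendsto_sandwich)
    show "(\<lambda>n. 0 :: real) \<longlonglongrightarrow> 0" by simp
    show "(\<lambda>n. C / real n) \<longlonglongrightarrow> 0" by real_asymp
    show "eventually (\<lambda>n. real n * E n (\<lambda>j. F n j ^ 4) \<le> C / real n) sequentially"
      using C eventually_gt_at_top[of 0] by eventually_elim (auto simp: field_simps power2_eq_square)
  qed simp
  show "(\<lambda>n. E n (\<lambda>j. \<bar>F n j\<bar>)) \<longlonglongrightarrow> 0"
  proof (rule tendsto_sandwich)
    show "(\<lambda>n. 0 :: real) \<longlonglongrightarrow> 0" by simp
    show "(\<lambda>n. 1 / sqrt (real n) + sqrt (real n) * (C / real n)) \<longlonglongrightarrow> 0" by real_asymp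
    show "eventually (\<lambda>n. E n (\<lambda>j. \<bar>F n j\<bar>) \<le> 1 / sqrt (real n) + sqrt (real n) * (C / real n)) sequentially"
      using C eventually_gt_at_top[of 0]
    proof eventually_elim
      case (elim n)
      define r where "r = sqrt (real n)"
      have r: "r > 0" using elim by (simp add: r_def)
      \<comment> \<open>The weight \<open>r\<close> balances the two summands, as \<open>(F n j)\<^sup>2\<close> has mean of order \<open>1 / r\<^sup>2\<close>.\<close>
      have "\<bar>F n j\<bar> \<le> 1 / r + r * (F n j)\<^sup>2" for j
      proof -
        have "0 \<le> (r * \<bar>F n j\<bar> - 1 / 2)\<^sup>2 + 3 / 4" by simp
        also have "\<dots> = r * (1 / r + r * (F n j)\<^sup>2 - \<bar>F n j\<bar>)"
          using r by (simp add: power2_eq_square field_simps abs_mult_self)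
        finally show ?thesis using r by (simp add: zero_le_mult_iff)
      qed
      then have "E n (\<lambda>j. \<bar>F n j\<bar>) \<le> E n (\<lambda>j. 1 / r + r * (F n j)\<^sup>2)"
        by (intro E_mono FK_intros)
      also have "\<dots> = 1 / r + r * E n (\<lambda>j. (F n j)\<^sup>2)" by (simp add: E_add FK_intros)
      also have "\<dots> \<le> 1 / r + r * (C / real n)" using elim r by (intro add_left_mono mult_left_mono) auto
      finally show ?case by (simp add: r_def)
    qed
  qed simp
qed

text \<open>
  The difference of the squares is the product of \<open>K - F\<close>, which is of order \<open>1 / n\<close>, and \<open>K + F\<close>,
  whose mean absolute value tends to \<open>0\<close>; so the factor \<open>n\<close> does not matter.
\<close>
lemma K_power2_asymp: "(\<lambda>n. real n * E n (\<lambda>j. (K n j)\<^sup>2) - real n * E n (\<lambda>j. (F n j)\<^sup>2)) \<longlonglongrightarrow> 0"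
  and K_power4_tendsto_0: "(\<lambda>n. real n * E n (\<lambda>j. K n j ^ 4)) \<longlonglongrightarrow> 0"
  and K_abs_tendsto_0: "(\<lambda>n. E n (\<lambda>j. \<bar>K n j\<bar>)) \<longlonglongrightarrow> 0"
proof -
  obtain C where C: "C \<ge> 0" "eventually (\<lambda>n. \<forall>j. \<bar>F n j - K n j\<bar> \<le> C * (1 + \<bar>F n j\<bar>) / real n
    \<and> \<bar>K n j\<bar> \<le> 2 * \<bar>F n j\<bar> + 1) sequentially" using K_near_F by blast
  have inv: "(\<lambda>n. 1 / real n) \<longlonglongrightarrow> 0" by real_asymp
  show "(\<lambda>n. real n * E n (\<lambda>j. (K n j)\<^sup>2) - real n * E n (\<lambda>j. (F n j)\<^sup>2)) \<longlonglongrightarrow> 0"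
  proof (rule Lim_null_comparison)
    have "(\<lambda>n. 2 * C * E n (\<lambda>j. \<bar>F n j\<bar>) + 2 * C * E n (\<lambda>j. (F n j)\<^sup>2) + 2 * C\<^sup>2 * (1 + E n (\<lambda>j. (F n j)\<^sup>2)) * (1 / real n))
        \<longlonglongrightarrow> 2 * C * 0 + 2 * C * 0 + 2 * C\<^sup>2 * (1 + 0) * 0"
      by (intro tendsto_intros inv F_abs_tendsto_0 F_power2_tendsto_0)
    then show "(\<lambda>n. 2 * C * E n (\<lambda>j. \<bar>F n j\<bar>) + 2 * C * E n (\<lambda>j. (F n j)\<^sup>2) + 2 * C\<^sup>2 * (1 + E n (\<lambda>j. (F n j)\<^sup>2)) * (1 / real n)) \<longlonglongrightarrow> 0" by simp
    show "eventually (\<lambda>n. norm (real n * E n (\<lambda>j. (K n j)\<^sup>2) - real n * E n (\<lambda>j. (F n j)\<^sup>2)) \<le>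
      2 * C * E n (\<lambda>j. \<bar>F n j\<bar>) + 2 * C * E n (\<lambda>j. (F n j)\<^sup>2) + 2 * C\<^sup>2 * (1 + E n (\<lambda>j. (F n j)\<^sup>2)) * (1 / real n)) sequentially"
      using C(2) eventually_gt_at_top[of 0]
    proof eventually_elim
      case (elim n)
      have *: "\<bar>real n * ((K n j)\<^sup>2 - (F n j)\<^sup>2)\<bar> \<le> 2 * C * \<bar>F n j\<bar> + 2 * C * (F n j)\<^sup>2 + 2 * C\<^sup>2 / real n * (1 + (F n j)\<^sup>2)" for j
      proof -
        define f where "f = \<bar>F n j\<bar>"
        have D: "\<bar>K n j - F n j\<bar> \<le> C * (1 + f) / real n" using elim by (simp add: f_def abs_minus_commute)
        then have "\<bar>K n j + F n j\<bar> \<le> 2 * f + C * (1 + f) / real n" unfolding f_def by linarith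
        then have "\<bar>K n j - F n j\<bar> * \<bar>K n j + F n j\<bar> \<le> (C * (1 + f) / real n) * (2 * f + C * (1 + f) / real n)"
          using D by (intro mult_mono) auto
        then have "real n * (\<bar>K n j - F n j\<bar> * \<bar>K n j + F n j\<bar>) \<le> real n * ((C * (1 + f) / real n) * (2 * f + C * (1 + f) / real n))"
          by (intro mult_left_mono) auto
        also have "\<dots> = C * (1 + f) * (2 * f + C * (1 + f) / real n)" using elim by simp
        also have "\<dots> = 2 * C * f + 2 * C * f\<^sup>2 + C\<^sup>2 / real n * (1 + f)\<^sup>2"
          by (simp add: power2_eq_square algebra_simps add_divide_distrib)
        also have "\<dots> \<le> 2 * C * f + 2 * C * f\<^sup>2 + C\<^sup>2 / real n * (2 * (1 + f\<^sup>2))"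
        proof -
          have "(1 + f)\<^sup>2 \<le> 2 * (1 + f\<^sup>2)" using sum_squares_ge_zero[of "1 - f" 0] by (simp add: power2_eq_square algebra_simps)
          then show ?thesis by (intro add_left_mono mult_left_mono) auto
        qed
        also have "\<dots> = 2 * C * f + 2 * C * f\<^sup>2 + 2 * C\<^sup>2 / real n * (1 + f\<^sup>2)" by simp
        finally have "real n * (\<bar>K n j - F n j\<bar> * \<bar>K n j + F n j\<bar>) \<le> \<dots>" .
        moreover have "\<bar>real n * ((K n j)\<^sup>2 - (F n j)\<^sup>2)\<bar> = real n * (\<bar>K n j - F n j\<bar> * \<bar>K n j + F n j\<bar>)"
          by (simp add: power2_eq_square square_diff_square_factored abs_mult mult.commute)
        ultimately show ?thesis by (simp only: f_def power2_abs)
      qed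
      have "\<bar>E n (\<lambda>j. real n * ((K n j)\<^sup>2 - (F n j)\<^sup>2))\<bar> \<le> E n (\<lambda>j. \<bar>real n * ((K n j)\<^sup>2 - (F n j)\<^sup>2)\<bar>)"
        by (rule integral_abs_bound)
      also have "\<dots> \<le> E n (\<lambda>j. 2 * C * \<bar>F n j\<bar> + 2 * C * (F n j)\<^sup>2 + 2 * C\<^sup>2 / real n * (1 + (F n j)\<^sup>2))"
        by (intro E_mono FK_intros *)
      also have "\<dots> = 2 * C * E n (\<lambda>j. \<bar>F n j\<bar>) + 2 * C * E n (\<lambda>j. (F n j)\<^sup>2) + 2 * C\<^sup>2 / real n * (1 + E n (\<lambda>j. (F n j)\<^sup>2))"
        by (simp add: E_add FK_intros)
      finally show ?case by (simp add: E_diff FK_intros right_diff_distrib[symmetric])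
    qed
  qed
  show "(\<lambda>n. real n * E n (\<lambda>j. K n j ^ 4)) \<longlonglongrightarrow> 0"
  proof (rule Lim_null_comparison)
    have inv3: "(\<lambda>n. 1 / real n ^ 3) \<longlonglongrightarrow> 0" and inv4: "(\<lambda>n. 1 / real n ^ 4) \<longlonglongrightarrow> 0" by real_asymp+
    have "(\<lambda>n. 8 * (real n * E n (\<lambda>j. F n j ^ 4)) + 128 * C ^ 4 * (1 / real n ^ 3 + real n * E n (\<lambda>j. F n j ^ 4) * (1 / real n ^ 4))) \<longlonglongrightarrow> 8 * 0 + 128 * C ^ 4 * (0 + 0 * 0)"
      by (intro tendsto_intros inv3 inv4 F_power4_tendsto_0)
    then show "(\<lambda>n. 8 * (real n * E n (\<lambda>j. F n j ^ 4)) + 128 * C ^ 4 * (1 / real n ^ 3 + real n * E n (\<lambda>j. F n j ^ 4) * (1 / real n ^ 4))) \<longlonglongrightarrow> 0" by simp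
    show "eventually (\<lambda>n. norm (real n * E n (\<lambda>j. K n j ^ 4)) \<le> 8 * (real n * E n (\<lambda>j. F n j ^ 4)) + 128 * C ^ 4 * (1 / real n ^ 3 + real n * E n (\<lambda>j. F n j ^ 4) * (1 / real n ^ 4))) sequentially"
      using C(2) eventually_gt_at_top[of 0]
    proof eventually_elim
      case (elim n)
      have *: "K n j ^ 4 \<le> 8 * F n j ^ 4 + 128 * C ^ 4 / real n ^ 4 * (1 + F n j ^ 4)" for j
      proof -
        define f where "f = \<bar>F n j\<bar>"
        define h where "h = C * (1 + f) / real n"
        have h: "h \<ge> 0" using C by (simp add: h_def f_def)
        have "\<bar>K n j - F n j\<bar> \<le> h" using elim by (simp add: f_def h_def abs_minus_commute)
        then have "\<bar>K n j\<bar> \<le> f + h" by (simp add: f_def)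
        then have "\<bar>K n j\<bar> ^ 4 \<le> (f + h) ^ 4" by (intro power_mono) auto
        also have "\<dots> = ((f + h)\<^sup>2)\<^sup>2" by simp
        also have "\<dots> \<le> (2 * (f\<^sup>2 + h\<^sup>2))\<^sup>2"
        proof (rule power_mono[OF _ zero_le_power2])
          show "(f + h)\<^sup>2 \<le> 2 * (f\<^sup>2 + h\<^sup>2)"
            using sum_squares_ge_zero[of "f - h" 0] by (simp add: power2_eq_square algebra_simps)
        qed
        also have "\<dots> = 4 * (f\<^sup>2 + h\<^sup>2)\<^sup>2" by algebra
        also have "(f\<^sup>2 + h\<^sup>2)\<^sup>2 \<le> 2 * (f ^ 4 + h ^ 4)"
          using sum_squares_ge_zero[of "f\<^sup>2 - h\<^sup>2" 0] by (simp add: power2_eq_square power4_eq_xxxx algebra_simps)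
        also have "h ^ 4 \<le> C ^ 4 * (16 * (1 + f ^ 4)) / real n ^ 4"
          unfolding h_def power_divide power_mult_distrib
          using one_plus_power_le[of f 4] by (intro divide_right_mono mult_left_mono) (auto simp: f_def)
        finally show ?thesis by (simp add: f_def algebra_simps)
      qed
      have "E n (\<lambda>j. K n j ^ 4) \<le> E n (\<lambda>j. 8 * F n j ^ 4 + 128 * C ^ 4 / real n ^ 4 * (1 + F n j ^ 4))"
        by (intro E_mono FK_intros *)
      also have "\<dots> = 8 * E n (\<lambda>j. F n j ^ 4) + 128 * C ^ 4 / real n ^ 4 * (1 + E n (\<lambda>j. F n j ^ 4))"
        by (simp add: E_add FK_intros)
      finally have "real n * E n (\<lambda>j. K n j ^ 4) \<le> real n * (8 * E n (\<lambda>j. F n j ^ 4) + 128 * C ^ 4 / real n ^ 4 * (1 + E n (\<lambda>j. F n j ^ 4)))"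
        by (intro mult_left_mono) auto
      also have "\<dots> = 8 * (real n * E n (\<lambda>j. F n j ^ 4)) + 128 * C ^ 4 * (1 / real n ^ 3 + real n * E n (\<lambda>j. F n j ^ 4) * (1 / real n ^ 4))"
        using elim by (simp add: field_simps power4_eq_xxxx power3_eq_cube)
      finally show ?case by simp
    qed
  qed
  show "(\<lambda>n. E n (\<lambda>j. \<bar>K n j\<bar>)) \<longlonglongrightarrow> 0"
  proof (rule Lim_null_comparison)
    have "(\<lambda>n. E n (\<lambda>j. \<bar>F n j\<bar>) + C * (1 / real n) * (1 + E n (\<lambda>j. \<bar>F n j\<bar>))) \<longlonglongrightarrow> 0 + C * 0 * (1 + 0)"
      by (intro tendsto_intros inv F_abs_tendsto_0)
    then show "(\<lambda>n. E n (\<lambda>j. \<bar>F n j\<bar>) + C * (1 / real n) * (1 + E n (\<lambda>j. \<bar>F n j\<bar>))) \<longlonglongrightarrow> 0" by simp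
    show "eventually (\<lambda>n. norm (E n (\<lambda>j. \<bar>K n j\<bar>)) \<le> E n (\<lambda>j. \<bar>F n j\<bar>) + C * (1 / real n) * (1 + E n (\<lambda>j. \<bar>F n j\<bar>))) sequentially"
      using C(2)
    proof eventually_elim
      case (elim n)
      have "\<bar>K n j\<bar> \<le> \<bar>F n j\<bar> + C * (1 / real n) * (1 + \<bar>F n j\<bar>)" for j
        using elim[rule_format, of j] abs_triangle_ineq2[of "K n j" "F n j"]
        by (simp add: abs_minus_commute[of "K n j"])
      then have "E n (\<lambda>j. \<bar>K n j\<bar>) \<le> E n (\<lambda>j. \<bar>F n j\<bar> + C * (1 / real n) * (1 + \<bar>F n j\<bar>))"
        by (intro E_mono FK_intros)
      also have "\<dots> = E n (\<lambda>j. \<bar>F n j\<bar>) + C * (1 / real n) * (1 + E n (\<lambda>j. \<bar>F n j\<bar>))"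
        by (simp add: E_add FK_intros)
      finally show ?case by simp
    qed
  qed
qed

lemma K_power2_tendsto_0: "(\<lambda>n. E n (\<lambda>j. (K n j)\<^sup>2)) \<longlonglongrightarrow> 0"
proof (rule Lim_transform_eventually)
  have inv: "(\<lambda>n. 1 / real n) \<longlonglongrightarrow> 0" by real_asymp
  from tendsto_add[OF tendsto_mult[OF K_power2_asymp inv] F_power2_tendsto_0]
  show "(\<lambda>n. (real n * E n (\<lambda>j. (K n j)\<^sup>2) - real n * E n (\<lambda>j. (F n j)\<^sup>2)) * (1 / real n) + E n (\<lambda>j. (F n j)\<^sup>2)) \<longlonglongrightarrow> 0"
    by simp
  show "eventually (\<lambda>n. (real n * E n (\<lambda>j. (K n j)\<^sup>2) - real n * E n (\<lambda>j. (F n j)\<^sup>2)) * (1 / real n) + E n (\<lambda>j. (F n j)\<^sup>2)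
    = E n (\<lambda>j. (K n j)\<^sup>2)) sequentially"
    using eventually_gt_at_top[of 0] by eventually_elim (simp add: field_simps)
qed

section \<open>The limit of the mean red excess\<close>

text \<open>
  The restriction on \<open>\<gamma>\<close> makes \<open>x powr \<gamma>\<close> controllable by \<open>(x powr (\<alpha> + 1))\<^sup>2\<close>, that is, by the first two
  absolute moments of \<open>K\<close>.
\<close>
lemma E_ratio_powr_tendsto_1:
  assumes \<gamma>: "0 < \<gamma>" "\<gamma> \<le> 2 * (\<alpha> + 1)"
  shows "(\<lambda>n. E n (\<lambda>j. (real j / real n) powr \<gamma>)) \<longlonglongrightarrow> 1"
proof -
  define b where "b = \<alpha> + 1"
  have b: "b > 0" using \<alpha>_pos by (simp add: b_def)
  have "(\<lambda>n. E n (\<lambda>j. (real j / real n) powr \<gamma>) - 1) \<longlonglongrightarrow> 0"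
  proof (rule Lim_null_comparison)
    have "(\<lambda>n. 2 * b * E n (\<lambda>j. \<bar>K n j\<bar>) + b\<^sup>2 * E n (\<lambda>j. (K n j)\<^sup>2)) \<longlonglongrightarrow> 2 * b * 0 + b\<^sup>2 * 0"
      by (intro tendsto_intros K_abs_tendsto_0 K_power2_tendsto_0)
    then show "(\<lambda>n. 2 * b * E n (\<lambda>j. \<bar>K n j\<bar>) + b\<^sup>2 * E n (\<lambda>j. (K n j)\<^sup>2)) \<longlonglongrightarrow> 0" by simp
    have "\<bar>E n (\<lambda>j. (real j / real n) powr \<gamma>) - 1\<bar> \<le> 2 * b * E n (\<lambda>j. \<bar>K n j\<bar>) + b\<^sup>2 * E n (\<lambda>j. (K n j)\<^sup>2)" for n
    proof -
      note intros = FK_intros poly_bounded_ratio_powr less_imp_le[OF \<gamma>(1)]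
      have "\<bar>E n (\<lambda>j. (real j / real n) powr \<gamma> - 1)\<bar> \<le> E n (\<lambda>j. \<bar>(real j / real n) powr \<gamma> - 1\<bar>)"
        by (rule integral_abs_bound)
      also have "\<dots> \<le> E n (\<lambda>j. 2 * b * \<bar>K n j\<bar> + b\<^sup>2 * (K n j)\<^sup>2)"
      proof (intro E_mono)
        fix j
        define x where "x = real j / real n"
        have x: "x \<ge> 0" by (simp add: x_def)
        have Kx: "x powr b = 1 + b * K n j" using b by (simp add: K_def x_def b_def)
        have "\<bar>x powr \<gamma> - 1\<bar> \<le> \<bar>x powr (b + b) - 1\<bar>"
          using \<gamma> x by (intro abs_powr_minus_one_mono) (auto simp: b_def)
        also have "x powr (b + b) - 1 = 2 * b * K n j + b\<^sup>2 * (K n j)\<^sup>2"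
          unfolding powr_add Kx by algebra
        also have "\<bar>\<dots>\<bar> \<le> 2 * b * \<bar>K n j\<bar> + b\<^sup>2 * (K n j)\<^sup>2"
          using b by (intro order.trans[OF abs_triangle_ineq]) (simp add: abs_mult)
        finally show "\<bar>(real j / real n) powr \<gamma> - 1\<bar> \<le> 2 * b * \<bar>K n j\<bar> + b\<^sup>2 * (K n j)\<^sup>2" by (simp add: x_def)
      qed (intro intros)+
      also have "\<dots> = 2 * b * E n (\<lambda>j. \<bar>K n j\<bar>) + b\<^sup>2 * E n (\<lambda>j. (K n j)\<^sup>2)"
        by (simp add: E_add FK_intros)
      finally show ?thesis by (simp add: E_diff intros)
    qed
    then show "eventually (\<lambda>n. norm (E n (\<lambda>j. (real j / real n) powr \<gamma>) - 1) \<le> 2 * b * E n (\<lambda>j. \<bar>K n j\<bar>) + b\<^sup>2 * E n (\<lambda>j. (K n j)\<^sup>2)) sequentially"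
      by simp
  qed
  from tendsto_add[OF this tendsto_const[of 1]] show ?thesis by simp
qed

text \<open>
  Replaces the random red count \<open>R\<close> by \<open>n\<close> in an asymptotic expression \<open>u R\<close>. Values of \<open>R\<close> so small that
  the asymptotics of \<open>u\<close> are not yet valid contribute only a bounded amount.
\<close>
lemma E_powr_asymp:
  assumes \<gamma>: "0 < \<gamma>" "\<gamma> \<le> 2 * (\<alpha> + 1)" and u: "(\<lambda>m. u m / real m powr \<gamma>) \<longlonglongrightarrow> L"
    and pb: "poly_bounded u"
  shows "(\<lambda>n. E n u / real n powr \<gamma>) \<longlonglongrightarrow> L"
proof -
  define v where "v m = u m - L * real m powr \<gamma>" for m
  have pbp: "poly_bounded (\<lambda>j. real j powr \<gamma>)" using \<gamma> by (intro poly_bounded_intros) auto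
  have pbv: "poly_bounded v" unfolding v_def by (intro poly_bounded_intros pb pbp)
  have "(\<lambda>m. v m / real m powr \<gamma>) \<longlonglongrightarrow> 0"
  proof (rule Lim_transform_eventually)
    show "(\<lambda>m. u m / real m powr \<gamma> - L) \<longlonglongrightarrow> 0" using u by (simp add: LIM_zero_iff)
    show "eventually (\<lambda>m. u m / real m powr \<gamma> - L = v m / real m powr \<gamma>) sequentially"
      using eventually_gt_at_top[of 0] by eventually_elim (simp add: v_def diff_divide_distrib)
  qed
  note v = this
  have "(\<lambda>n. E n v / real n powr \<gamma>) \<longlonglongrightarrow> 0"
  proof (rule LIMSEQ_I)
    fix e :: real assume e: "e > 0"
    have "eventually (\<lambda>m. \<bar>v m / real m powr \<gamma>\<bar> < e / 4) sequentially"
      using order_tendstoD(2)[OF tendsto_rabs_zero[OF v], of "e / 4"] e by simp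
    then obtain N where N: "\<And>m. m \<ge> N \<Longrightarrow> \<bar>v m / real m powr \<gamma>\<bar> < e / 4"
      by (auto simp: eventually_at_top_linorder)
    define D where "D = (\<Sum>m<Suc N. \<bar>v m\<bar>)"
    have D: "D \<ge> 0" by (simp add: D_def sum_nonneg)
    have vb: "\<bar>v m\<bar> \<le> D + e / 4 * real m powr \<gamma>" for m
    proof (cases "m \<le> N")
      case True
      then have "\<bar>v m\<bar> \<le> D" unfolding D_def by (intro member_le_sum) auto
      then show ?thesis using e by (simp add: add_increasing2)
    next
      case False
      then have "\<bar>v m\<bar> \<le> e / 4 * real m powr \<gamma>" using N[of m] by (simp add: field_simps)
      with D show ?thesis by simp
    qed
    have "(\<lambda>n. D / real n powr \<gamma>) \<longlonglongrightarrow> 0" using \<gamma> by real_asymp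
    then have "eventually (\<lambda>n. D / real n powr \<gamma> < e / 4) sequentially"
      by (rule order_tendstoD) (use e in auto)
    moreover have "eventually (\<lambda>n. E n (\<lambda>j. (real j / real n) powr \<gamma>) < 2) sequentially"
      using E_ratio_powr_tendsto_1[OF \<gamma>] by (rule order_tendstoD) auto
    ultimately have "eventually (\<lambda>n. norm (E n v / real n powr \<gamma> - 0) < e) sequentially"
      using eventually_gt_at_top[of 0]
    proof eventually_elim
      case (elim n)
      have pos: "real n powr \<gamma> > 0" using elim by simp
      have "\<bar>E n v\<bar> \<le> E n (\<lambda>j. \<bar>v j\<bar>)" by (rule integral_abs_bound)
      also have "\<dots> \<le> E n (\<lambda>j. D + e / 4 * real j powr \<gamma>)"
        by (intro E_mono poly_bounded_intros pbp pbv vb)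
      also have "\<dots> = D + e / 4 * E n (\<lambda>j. real j powr \<gamma>)" by (simp add: E_add pbp poly_bounded_intros)
      finally have "\<bar>E n v\<bar> / real n powr \<gamma> \<le> (D + e / 4 * E n (\<lambda>j. real j powr \<gamma>)) / real n powr \<gamma>"
        using pos by (intro divide_right_mono) auto
      also have "\<dots> = D / real n powr \<gamma> + e / 4 * E n (\<lambda>j. (real j / real n) powr \<gamma>)"
        by (simp add: powr_divide add_divide_distrib)
      also have "\<dots> < e / 4 + e / 4 * 2" using elim e by (intro add_strict_mono mult_strict_left_mono) auto
      also have "\<dots> \<le> e" using e by simp
      finally show ?case by simp
    qed
    then show "\<exists>N. \<forall>n\<ge>N. norm (E n v / real n powr \<gamma> - 0) < e" by (auto simp: eventually_at_top_linorder)
  qed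
  from tendsto_add[OF this tendsto_mult[OF tendsto_const[of L] E_ratio_powr_tendsto_1[OF \<gamma>]]]
  have "(\<lambda>n. E n v / real n powr \<gamma> + L * E n (\<lambda>j. (real j / real n) powr \<gamma>)) \<longlonglongrightarrow> L" by simp
  moreover have "E n v / real n powr \<gamma> + L * E n (\<lambda>j. (real j / real n) powr \<gamma>) = E n u / real n powr \<gamma>" for n
    unfolding v_def by (simp add: E_diff pb pbp poly_bounded_intros powr_divide diff_divide_distrib)
  ultimately show ?thesis by simp
qed

text \<open>
  The mean of \<open>S 2\<close> is asymptotically twice the sum of \<open>i powr (2 * \<alpha>)\<close> for \<open>i < n\<close>: one half from each
  colour.
\<close>
lemma F_power2_limit: "(\<lambda>n. real n * E n (\<lambda>j. (F n j)\<^sup>2)) \<longlonglongrightarrow> 2 / (2 * \<alpha> + 1)"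
proof (rule Lim_transform_eventually)
  define \<gamma> where "\<gamma> = 2 * \<alpha> + 1"
  let ?R = "\<lambda>m. \<Sum>i<m. \<rho> i ^ 2" and ?B = "\<lambda>m. \<Sum>i<m. \<beta> i ^ 2"
  have pb: "poly_bounded ?R" by (intro poly_bounded_intros \<rho>_poly)
  have "(\<lambda>n. E n ?R / real n powr \<gamma>) \<longlonglongrightarrow> 1 / \<gamma>"
    using power_sum_\<rho>_asymp[of 2] \<alpha>_pos by (intro E_powr_asymp pb) (auto simp: \<gamma>_def)
  moreover have "(\<lambda>n. ?B n / real n powr \<gamma>) \<longlonglongrightarrow> 1 / \<gamma>"
    using power_sum_\<beta>_asymp[of 2] by (simp add: \<gamma>_def)
  ultimately have "(\<lambda>n. E n ?R / real n powr \<gamma> + ?B n / real n powr \<gamma>) \<longlonglongrightarrow> 1 / \<gamma> + 1 / \<gamma>"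
    by (rule tendsto_add)
  then show "(\<lambda>n. E n ?R / real n powr \<gamma> + ?B n / real n powr \<gamma>) \<longlonglongrightarrow> 2 / (2 * \<alpha> + 1)"
    by (simp add: \<gamma>_def)
  show "eventually (\<lambda>n. E n ?R / real n powr \<gamma> + ?B n / real n powr \<gamma> = real n * E n (\<lambda>j. (F n j)\<^sup>2)) sequentially"
    using eventually_gt_at_top[of 0]
  proof eventually_elim
    case (elim n)
    have np: "(real n powr (\<alpha> + 1))\<^sup>2 = real n * real n powr \<gamma>"
    proof -
      have "(real n powr (\<alpha> + 1))\<^sup>2 = real n powr (1 + \<gamma>)"
        by (simp add: power2_eq_square powr_add[symmetric] \<gamma>_def algebra_simps)
      then show ?thesis using elim by (simp add: powr_add)
    qed
    have "E n (\<lambda>j. (F n j)\<^sup>2) = E n (\<lambda>j. (Y n j)\<^sup>2) / (real n powr (\<alpha> + 1))\<^sup>2"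
      unfolding F_def by (simp add: power_divide)
    also have "E n (\<lambda>j. (Y n j)\<^sup>2) = E n ?R + ?B n"
      unfolding E_Y_power2 S_def by (simp add: E_add pb poly_bounded_intros)
    finally show ?case unfolding np using elim by (simp add: add_divide_distrib distrib_left)
  qed
qed

lemma K_power2_limit: "(\<lambda>n. real n * E n (\<lambda>j. (K n j)\<^sup>2)) \<longlonglongrightarrow> 2 / (2 * \<alpha> + 1)"
  using tendsto_add[OF K_power2_asymp F_power2_limit] by simp

text \<open>
  Since \<open>Y\<close> has mean zero, the mean of \<open>H R - H n\<close> equals the difference of the second-order terms of
  the two partial sums; the Euler--Maclaurin constants cancel.
\<close>
lemma K_limit: "(\<lambda>n. real n * E n (K n)) \<longlonglongrightarrow> (c' - c) / \<alpha>"
proof (rule Lim_transform_eventually)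
  let ?R = "\<lambda>m. \<Sum>i<m. \<rho> i" and ?B = "\<lambda>m. \<Sum>i<m. \<beta> i"
  have pbR: "poly_bounded ?R" by (intro poly_bounded_intros \<rho>_poly)
  have pbH: "poly_bounded H" unfolding H_def using \<alpha>_pos by (intro poly_bounded_intros) auto
  have "(\<lambda>n. E n (\<lambda>j. ?R j - H j) / real n powr \<alpha>) \<longlonglongrightarrow> c / \<alpha> - 1 / 2"
    using \<alpha>_pos by (intro E_powr_asymp sum_\<rho>_asymp poly_bounded_diff pbR pbH) auto
  from tendsto_diff[OF sum_\<beta>_asymp this]
  show "(\<lambda>n. (?B n - H n) / real n powr \<alpha> - E n (\<lambda>j. ?R j - H j) / real n powr \<alpha>) \<longlonglongrightarrow> (c' - c) / \<alpha>"
    by (simp add: diff_divide_distrib)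
  show "eventually (\<lambda>n. (?B n - H n) / real n powr \<alpha> - E n (\<lambda>j. ?R j - H j) / real n powr \<alpha> = real n * E n (K n)) sequentially"
    using eventually_gt_at_top[of 0]
  proof eventually_elim
    case (elim n)
    have "E n (\<lambda>j. ?R j - ?B n) = 0" using E_Y[of n] by (simp add: Y_def[abs_def])
    then have mean: "E n ?R = ?B n" by (simp add: E_diff pbR poly_bounded_intros)
    have "real n * K n j = (H j - H n) / real n powr \<alpha>" for j
    proof -
      define b where "b = \<alpha> + 1"
      have b: "b > 0" "real n powr b = real n * real n powr \<alpha>" "real n powr \<alpha> > 0"
        using elim \<alpha>_pos by (auto simp: b_def powr_add)
      have "real n * K n j = real n * ((real j powr b / real n powr b - 1) / b)"
        by (simp add: K_def b_def powr_divide)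
      also have "\<dots> = (real j powr b / b - real n powr b / b) / real n powr \<alpha>"
        using b elim by (simp add: field_simps)
      finally show ?thesis by (simp add: H_def b_def)
    qed
    then have "real n * E n (K n) = E n (\<lambda>j. (H j - H n) / real n powr \<alpha>)"
      by (simp flip: integral_mult_right_zero)
    also have "\<dots> = (E n H - H n) / real n powr \<alpha>" by (simp add: E_diff pbH poly_bounded_intros)
    finally show ?case by (simp add: E_diff pbR pbH mean diff_divide_distrib)
  qed
qed

lemma red_excess_limit:
  "(\<lambda>n. E n (\<lambda>j. real j - real n)) \<longlonglongrightarrow> (c' - c) / \<alpha> - \<alpha> / (2 * \<alpha> + 1)"
proof -
  define u where "u n j = real j / real n - 1 - K n j + \<alpha> / 2 * (K n j)\<^sup>2" for n j
  have pbu: "poly_bounded (u n)" for n unfolding u_def by (intro FK_intros)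
  have "(\<lambda>n. real n * E n (u n)) \<longlonglongrightarrow> 0"
  proof (rule LIMSEQ_I)
    fix e :: real assume e: "e > 0"
    define \<epsilon> where "\<epsilon> = e / 8"
    have "\<epsilon> > 0" using e by (simp add: \<epsilon>_def)
    then obtain C where C: "C \<ge> 0" "\<And>x. x \<ge> 0 \<Longrightarrow> \<bar>x - 1 - (x powr (\<alpha> + 1) - 1) / (\<alpha> + 1) + \<alpha> / 2 * ((x powr (\<alpha> + 1) - 1) / (\<alpha> + 1))\<^sup>2\<bar>
      \<le> \<epsilon> * ((x powr (\<alpha> + 1) - 1) / (\<alpha> + 1))\<^sup>2 + C * ((x powr (\<alpha> + 1) - 1) / (\<alpha> + 1)) ^ 4"
      using inverse_powr_expansion[OF \<alpha>_pos, of \<epsilon>] by blast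
    have ub: "\<bar>u n j\<bar> \<le> \<epsilon> * (K n j)\<^sup>2 + C * K n j ^ 4" for n j
      using C(2)[of "real j / real n"] by (simp add: u_def K_def)
    have "eventually (\<lambda>n. real n * E n (\<lambda>j. (K n j)\<^sup>2) < 4) sequentially"
      by (rule order_tendstoD[OF K_power2_limit]) (use \<alpha>_pos in \<open>auto simp: field_simps\<close>)
    moreover have "(\<lambda>n. C * (real n * E n (\<lambda>j. K n j ^ 4))) \<longlonglongrightarrow> C * 0"
      by (intro tendsto_intros K_power4_tendsto_0)
    then have "eventually (\<lambda>n. C * (real n * E n (\<lambda>j. K n j ^ 4)) < e / 2) sequentially"
      by (rule order_tendstoD) (use e in auto)
    ultimately have "eventually (\<lambda>n. norm (real n * E n (u n) - 0) < e) sequentially"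
    proof eventually_elim
      case (elim n)
      have "\<bar>E n (u n)\<bar> \<le> E n (\<lambda>j. \<bar>u n j\<bar>)" by (rule integral_abs_bound)
      also have "\<dots> \<le> E n (\<lambda>j. \<epsilon> * (K n j)\<^sup>2 + C * K n j ^ 4)"
        by (intro E_mono FK_intros pbu ub)
      also have "\<dots> = \<epsilon> * E n (\<lambda>j. (K n j)\<^sup>2) + C * E n (\<lambda>j. K n j ^ 4)" by (simp add: E_add FK_intros)
      finally have "real n * \<bar>E n (u n)\<bar> \<le> real n * (\<epsilon> * E n (\<lambda>j. (K n j)\<^sup>2) + C * E n (\<lambda>j. K n j ^ 4))"
        by (intro mult_left_mono) auto
      also have "\<dots> = \<epsilon> * (real n * E n (\<lambda>j. (K n j)\<^sup>2)) + C * (real n * E n (\<lambda>j. K n j ^ 4))"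
        by (simp add: algebra_simps)
      also have "\<dots> < \<epsilon> * 4 + e / 2"
        using elim \<open>\<epsilon> > 0\<close> by (intro add_strict_mono mult_strict_left_mono) auto
      also have "\<dots> = e" by (simp add: \<epsilon>_def)
      finally show ?case by (simp add: abs_mult)
    qed
    then show "\<exists>N. \<forall>n\<ge>N. norm (real n * E n (u n) - 0) < e" by (auto simp: eventually_at_top_linorder)
  qed
  from tendsto_add[OF tendsto_diff[OF K_limit tendsto_mult[OF tendsto_const[of "\<alpha> / 2"] K_power2_limit]] this]
  have "(\<lambda>n. real n * E n (K n) - \<alpha> / 2 * (real n * E n (\<lambda>j. (K n j)\<^sup>2)) + real n * E n (u n))
      \<longlonglongrightarrow> (c' - c) / \<alpha> - \<alpha> / (2 * \<alpha> + 1)" by simp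
  then show ?thesis
  proof (rule Lim_transform_eventually)
    show "eventually (\<lambda>n. real n * E n (K n) - \<alpha> / 2 * (real n * E n (\<lambda>j. (K n j)\<^sup>2)) + real n * E n (u n) =
      E n (\<lambda>j. real j - real n)) sequentially"
      using eventually_gt_at_top[of 0]
    proof eventually_elim
      case (elim n)
      have "(\<lambda>j. real j - real n) = (\<lambda>j. real n * K n j - \<alpha> / 2 * (real n * (K n j)\<^sup>2) + real n * u n j)"
        using elim by (intro ext) (simp add: u_def algebra_simps)
      then show ?case by (simp add: E_add E_diff FK_intros pbu)
    qed
  qed
qed

end

section \<open>Measurability and paths of the urn process\<close>

lemma measurable_Inf_enat:
  assumes "\<And>m. Measurable.pred M (Q m)"
  shows "(\<lambda>\<omega>. Inf {enat m | m. Q m \<omega>}) \<in> measurable M (count_space UNIV)"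
proof -
  have "Inf {enat m | m. Q m \<omega>} = (if \<exists>m. Q m \<omega> then enat (LEAST m. Q m \<omega>) else \<infinity>)" for \<omega>
  proof (cases "\<exists>m. Q m \<omega>")
    case True
    have "Inf {enat m | m. Q m \<omega>} = enat (LEAST m. Q m \<omega>)"
    proof (rule antisym)
      show "Inf {enat m | m. Q m \<omega>} \<le> enat (LEAST m. Q m \<omega>)"
        using LeastI_ex[OF True] by (intro Inf_lower) auto
      show "enat (LEAST m. Q m \<omega>) \<le> Inf {enat m | m. Q m \<omega>}"
        by (intro Inf_greatest) (auto intro: Least_le)
    qed
    with True show ?thesis by simp
  next
    case False
    then have "{enat m | m. Q m \<omega>} = {}" by blast
    with False show ?thesis by (simp add: top_enat_def)
  qed
  moreover have "(\<lambda>\<omega>. if \<exists>m. Q m \<omega> then enat (LEAST m. Q m \<omega>) else \<infinity>) \<in> measurable M (count_space UNIV)"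
    using assms by measurable
  ultimately show ?thesis by simp
qed

context polya_urn
begin

lemma measurable_X [measurable]: "X n \<in> measurable M (count_space UNIV)"
  by (rule measurable_state)

text \<open>
  Countability of \<open>enat\<close> makes the discrete \<open>\<sigma>\<close>-algebra the convenient one, as it allows random
  times to be substituted into the process.
\<close>
lemma measurable_blue_time [measurable]: "blue_time X k \<in> measurable M (count_space UNIV)"
proof (induction k)
  case (Suc k)
  have [measurable]: "Measurable.pred M (\<lambda>\<omega>. blue_time X k \<omega> < enat m)" for m
    by (rule measurable_compose[OF Suc]) simp
  have [measurable]: "blue X m \<in> measurable M (count_space UNIV)" for m
    unfolding blue_def by (rule measurable_compose[OF measurable_X]) simp
  have [measurable]: "Measurable.pred M (\<lambda>\<omega>. \<exists>i. blue X m \<omega> = Suc i \<and> blue X (m - 1) \<omega> = i)" for m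
    by measurable
  have "Measurable.pred M (\<lambda>\<omega>. blue_time X k \<omega> < enat m \<and> 
      (\<exists>i. blue X m \<omega> = Suc i \<and> blue X (m - 1) \<omega> = i))" for m
    by measurable
  then show ?case unfolding blue_time.simps by (intro measurable_Inf_enat) simp
qed (simp add: zero_enat_def)

lemma measurable_state_at_blue [measurable]:
  "(\<lambda>\<omega>. X (the_enat (blue_time X k \<omega>)) \<omega>) \<in> measurable M (count_space UNIV)"
  by (rule measurable_compose_countable[where f = X]) measurable

text \<open>
  The Markov property is given for whole paths; summing over the countably many paths up to time \<open>n\<close> that
  end in \<open>s\<close> gives it for single steps.
\<close>
lemma transition_prob:
  "\<P>(\<omega> in M. X n \<omega> = s \<and> X (Suc n) \<omega> = t) = \<P>(\<omega> in M. X n \<omega> = s) * urn_kernel b r s t"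
proof -
  define J where "J = {y \<in> PiE {..n} (\<lambda>_. UNIV :: (nat \<times> nat) set). y n = s}"
  define A where "A y = {\<omega> \<in> space M. \<forall>k\<le>n. X k \<omega> = y k}" for y
  define A' where "A' y = {\<omega> \<in> space M. \<forall>k\<le>Suc n. X k \<omega> = (y(Suc n := t)) k}" for y
  have sets: "A y \<in> sets M" "A' y \<in> sets M" for y unfolding A_def A'_def by measurable
  have "countable J"
    unfolding J_def by (rule countable_subset[of _ "PiE {..n} (\<lambda>_. UNIV)"]) (auto intro: countable_PiE)
  have uniq: "restrict (\<lambda>k. X k \<omega>) {..n} = y" if "y \<in> J" "\<forall>k\<le>n. X k \<omega> = y k" for y \<omega>
    using that by (intro PiE_ext[of _ "{..n}" "\<lambda>_. UNIV"]) (auto simp: J_def)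
  have A'_alt: "A' y = {\<omega> \<in> A y. X (Suc n) \<omega> = t}" for y
    unfolding A_def A'_def by (auto simp: le_Suc_eq)
  have disj: "disjoint_family_on A J"
    unfolding disjoint_family_on_def A_def using uniq by blast
  have disj': "disjoint_family_on A' J"
    using disj unfolding disjoint_family_on_def A'_alt by blast
  have UN: "{\<omega> \<in> space M. X n \<omega> = s} = (\<Union>y\<in>J. A y)"
  proof (intro equalityI subsetI)
    fix \<omega> assume "\<omega> \<in> {\<omega> \<in> space M. X n \<omega> = s}"
    then have "restrict (\<lambda>k. X k \<omega>) {..n} \<in> J" "\<omega> \<in> A (restrict (\<lambda>k. X k \<omega>) {..n})"
      by (auto simp: J_def A_def)
    then show "\<omega> \<in> (\<Union>y\<in>J. A y)" by blast
  qed (auto simp: J_def A_def)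
  then have UN': "{\<omega> \<in> space M. X n \<omega> = s \<and> X (Suc n) \<omega> = t} = (\<Union>y\<in>J. A' y)"
    unfolding A'_alt by blast
  have kernel_nonneg: "urn_kernel b r s t \<ge> 0"
    using blue_weights_pos red_weights_pos by (simp add: urn_kernel_def less_imp_le add_pos_pos)
  have step: "emeasure M (A' y) = emeasure M (A y) * ennreal (urn_kernel b r s t)" if "y \<in> J" for y
  proof -
    have "measure M (A' y) = measure M {\<omega> \<in> space M. \<forall>k\<le>n. X k \<omega> = (y(Suc n := t)) k} * urn_kernel b r ((y(Suc n := t)) n) ((y(Suc n := t)) (Suc n))"
      unfolding A'_def by (rule markov)
    also have "{\<omega> \<in> space M. \<forall>k\<le>n. X k \<omega> = (y(Suc n := t)) k} = A y"
      unfolding A_def by auto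
    finally show ?thesis using that kernel_nonneg
      by (simp add: emeasure_eq_measure ennreal_mult[symmetric] J_def)
  qed
  have "emeasure M {\<omega> \<in> space M. X n \<omega> = s \<and> X (Suc n) \<omega> = t} = (\<integral>\<^sup>+y. emeasure M (A' y) \<partial>count_space J)"
    unfolding UN' using sets \<open>countable J\<close> disj' by (intro emeasure_UN_countable) auto
  also have "\<dots> = (\<integral>\<^sup>+y. emeasure M (A y) * ennreal (urn_kernel b r s t) \<partial>count_space J)"
    by (intro nn_integral_cong) (simp add: step)
  also have "\<dots> = (\<integral>\<^sup>+y. emeasure M (A y) \<partial>count_space J) * ennreal (urn_kernel b r s t)"
    by (rule nn_integral_multc) simp
  also have "(\<integral>\<^sup>+y. emeasure M (A y) \<partial>count_space J) = emeasure M {\<omega> \<in> space M. X n \<omega> = s}"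
    unfolding UN using sets \<open>countable J\<close> disj by (intro emeasure_UN_countable[symmetric]) auto
  finally show ?thesis
    using kernel_nonneg by (simp add: emeasure_eq_measure ennreal_mult[symmetric] del: ennreal_mult)
qed

definition unit_steps :: "'a \<Rightarrow> bool" where
  "unit_steps \<omega> \<longleftrightarrow> X 0 \<omega> = (0, 0) \<and> (\<forall>n. X (Suc n) \<omega> \<in>
     {(Suc (fst (X n \<omega>)), snd (X n \<omega>)), (fst (X n \<omega>), Suc (snd (X n \<omega>)))})"

lemma AE_unit_steps: "AE \<omega> in M. unit_steps \<omega>"
proof -
  have "AE \<omega> in M. \<not> (X n \<omega> = s \<and> X (Suc n) \<omega> = t)"
    if "t \<notin> {(Suc (fst s), snd s), (fst s, Suc (snd s))}" for n s t
  proof -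
    have "\<P>(\<omega> in M. X n \<omega> = s \<and> X (Suc n) \<omega> = t) = 0"
      using that unfolding transition_prob by (simp add: urn_kernel_def)
    then show ?thesis by (subst (asm) prob_eq_0) auto
  qed
  then have "AE \<omega> in M. \<forall>n s t. t \<notin> {(Suc (fst s), snd s), (fst s, Suc (snd s))} \<longrightarrow>
      \<not> (X n \<omega> = s \<and> X (Suc n) \<omega> = t)"
    by (simp only: AE_all_countable AE_impI) auto
  with start show ?thesis
  proof eventually_elim
    case (elim \<omega>)
    then show ?case unfolding unit_steps_def by blast
  qed
qed

section \<open>Visiting probabilities of the urn process\<close>

text \<open>
  \<open>blue_at n j\<close> is the probability that the \<open>n\<close>-th blue ball is drawn when \<open>j\<close> red balls are present.
  The case \<open>n = 0\<close> follows the convention that the zeroth blue ball is drawn at time \<open>0\<close>.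
\<close>
definition visit :: "nat \<Rightarrow> nat \<Rightarrow> real" where
  "visit i j = \<P>(\<omega> in M. X (i + j) \<omega> = (i, j))"

definition blue_at :: "nat \<Rightarrow> nat \<Rightarrow> real" where
  "blue_at n j = (if n = 0 then of_bool (j = 0)
     else \<P>(\<omega> in M. X (n - 1 + j) \<omega> = (n - 1, j) \<and> X (n + j) \<omega> = (n, j)))"

lemma blue_at_0: "blue_at 0 j = of_bool (j = 0)"
  by (simp add: blue_at_def)

lemma blue_at_Suc: "blue_at (Suc n) j = visit n j * (b n / (b n + r j))"
  using transition_prob[of "n + j" "(n, j)" "(Suc n, j)"]
  by (simp add: blue_at_def visit_def urn_kernel_def)

text \<open>
  A state other than the origin is almost surely entered by a blue or by a red draw, and these events are
  disjoint because they prescribe different predecessors. The convention for \<open>blue_at 0\<close> accounts for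
  the start at the origin.
\<close>
lemma visit_eq: "visit i j = blue_at i j + (if j = 0 then 0 else visit i (j - 1) * (r (j - 1) / (b i + r (j - 1))))"
proof -
  let ?Blue = "{\<omega> \<in> space M. i > 0 \<and> X (i - 1 + j) \<omega> = (i - 1, j) \<and> X (i + j) \<omega> = (i, j)}"
  let ?Red = "{\<omega> \<in> space M. j > 0 \<and> X (i + (j - 1)) \<omega> = (i, j - 1) \<and> X (Suc (i + (j - 1))) \<omega> = (i, j)}"
  have red: "prob ?Red = (if j = 0 then 0 else visit i (j - 1) * (r (j - 1) / (b i + r (j - 1))))"
    using transition_prob[of "i + (j - 1)" "(i, j - 1)" "(i, j)"]
    by (auto simp: visit_def urn_kernel_def)
  show ?thesis
  proof (cases "i = 0 \<and> j = 0")
    case True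
    have "\<P>(\<omega> in M. X 0 \<omega> = (0, 0)) = 1" using start by (subst prob_eq_1) auto
    with True show ?thesis by (simp add: visit_def blue_at_0)
  next
    case False
    have blue: "prob ?Blue = blue_at i j" using False by (auto simp: blue_at_def)
    have "visit i j = prob (?Blue \<union> ?Red)"
      unfolding visit_def
    proof (rule measure_eq_AE)
      show "AE \<omega> in M. \<omega> \<in> {\<omega> \<in> space M. X (i + j) \<omega> = (i, j)} \<longleftrightarrow> \<omega> \<in> ?Blue \<union> ?Red"
        using AE_unit_steps
      proof eventually_elim
        case (elim \<omega>)
        define m where "m = i + j - 1"
        have m: "i + j = Suc m" using False by (auto simp: m_def)
        have step: "X (Suc m) \<omega> \<in> {(Suc (fst (X m \<omega>)), snd (X m \<omega>)), (fst (X m \<omega>), Suc (snd (X m \<omega>)))}"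
          using elim unfolding unit_steps_def by blast
        have "i > 0 \<Longrightarrow> i - 1 + j = m" "j > 0 \<Longrightarrow> i + (j - 1) = m" using m by auto
        with step m show ?case
          by (cases "X m \<omega>"; cases i; cases j) auto
      qed
    qed measurable
    also have "\<dots> = prob ?Blue + prob ?Red"
    proof (rule finite_measure_Union)
      show "?Blue \<inter> ?Red = {}" by (cases i; cases j) auto
    qed measurable
    finally show ?thesis unfolding red blue .
  qed
qed

lemma blue_at_balance:
  "blue_at (Suc n) j * (1 + r j / b n) =
     blue_at n j + (if j = 0 then 0 else blue_at (Suc n) (j - 1) * (r (j - 1) / b n))"
proof -
  have pos: "b n > 0 \<and> r j > 0" for j using blue_weights_pos red_weights_pos by auto
  have nz: "b n + r j \<noteq> 0" for j using pos[of j] by linarith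
  have "blue_at (Suc n) j * (1 + r j / b n) = visit n j"
  proof -
    have "1 + r j / b n = (b n + r j) / b n" using pos[of j] by (simp add: add_divide_distrib)
    then show ?thesis unfolding blue_at_Suc using pos[of j] nz[of j] by simp
  qed
  moreover have "blue_at (Suc n) (j - 1) * (r (j - 1) / b n) = visit n (j - 1) * (r (j - 1) / (b n + r (j - 1)))"
    unfolding blue_at_Suc using pos[of "j - 1"] nz[of "j - 1"] by (simp add: field_simps)
  ultimately show ?thesis using visit_eq[of n j] by simp
qed

lemma blue_at_nonneg: "blue_at n j \<ge> 0" and blue_at_le_1: "blue_at n j \<le> 1"
  by (auto simp: blue_at_def)

text \<open>
  Summing the balance equation over \<open>j \<le> m\<close> leaves only the flux out of \<open>m\<close>, and this vanishes in the
  limit as \<open>r\<close> tends to \<open>0\<close>. No mass escapes to infinity: the next blue ball is drawn almost surely.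
\<close>
lemma blue_at_sums_1:
  assumes r0: "r \<longlonglongrightarrow> 0"
  shows "blue_at n sums 1"
proof (induction n)
  case 0
  show ?case using sums_single[of 0 "\<lambda>_. 1 :: real"] by (simp add: blue_at_0[abs_def] of_bool_def)
next
  case (Suc n)
  have telescope: "(\<Sum>j\<le>m. blue_at (Suc n) j) = (\<Sum>j\<le>m. blue_at n j) - blue_at (Suc n) m * (r m / b n)" for m
  proof (induction m)
    case 0
    show ?case using blue_at_balance[of n 0] by (simp add: algebra_simps)
  next
    case (Suc m)
    show ?case using blue_at_balance[of n "Suc m"] Suc by (simp add: algebra_simps)
  qed
  have "(\<lambda>m. blue_at (Suc n) m * (r m / b n)) \<longlonglongrightarrow> 0"
  proof (rule Lim_null_comparison)
    have "(\<lambda>m. r m / b n) \<longlonglongrightarrow> 0 / b n"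
      using r0 blue_weights_pos[of n] by (intro tendsto_intros) auto
    then show "(\<lambda>m. r m / b n) \<longlonglongrightarrow> 0" by simp
    have "blue_at (Suc n) m * (r m / b n) \<le> 1 * (r m / b n)" for m
      using blue_at_le_1 blue_weights_pos[of n] red_weights_pos[of m] by (intro mult_right_mono) auto
    moreover have "0 \<le> blue_at (Suc n) m * (r m / b n)" for m
      using blue_at_nonneg blue_weights_pos[of n] red_weights_pos[of m] by simp
    ultimately show "eventually (\<lambda>m. norm (blue_at (Suc n) m * (r m / b n)) \<le> r m / b n) sequentially"
      by (simp only: real_norm_def abs_of_nonneg mult_1 eventually_True)
  qed
  from tendsto_diff[OF Suc[unfolded sums_def_le] this]
  have "(\<lambda>m. \<Sum>j\<le>m. blue_at (Suc n) j) \<longlonglongrightarrow> 1" unfolding telescope by simp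
  then show ?case unfolding sums_def_le .
qed

definition red_law :: "nat \<Rightarrow> nat pmf" where "red_law n = embed_pmf (blue_at n)"

lemma pmf_red_law: 
  assumes "r \<longlonglongrightarrow> 0" shows "pmf (red_law n) j = blue_at n j"
  unfolding red_law_def
proof (rule pmf_embed_pmf)
  have "(\<integral>\<^sup>+ j. ennreal (blue_at n j) \<partial>count_space UNIV) = (\<Sum>j. ennreal (blue_at n j))"
    by (rule nn_integral_count_space_nat)
  also have "\<dots> = ennreal (\<Sum>j. blue_at n j)"
    using blue_at_sums_1[OF assms] blue_at_nonneg by (intro suminf_ennreal2) (auto simp: sums_iff)
  also have "\<dots> = 1" using blue_at_sums_1[OF assms, of n] by (simp add: sums_iff)
  finally show "(\<integral>\<^sup>+ j. ennreal (blue_at n j) \<partial>count_space UNIV) = 1" .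
qed (rule blue_at_nonneg)

section \<open>Reduction of the discrepancy to the law of the red count\<close>

lemma blue_mono:
  assumes "unit_steps \<omega>" "m \<le> m'" shows "blue X m \<omega> \<le> blue X m' \<omega>"
proof (rule lift_Suc_mono_le[OF _ assms(2)])
  fix n
  have "X (Suc n) \<omega> \<in> {(Suc (fst (X n \<omega>)), snd (X n \<omega>)), (fst (X n \<omega>), Suc (snd (X n \<omega>)))}"
    using assms(1) unfolding unit_steps_def by blast
  then show "blue X n \<omega> \<le> blue X (Suc n) \<omega>" by (auto simp: blue_def)
qed

text \<open>
  Blue counts increase by at most one, so the recursively defined time of the \<open>n\<close>-th increase is the
  first time at which the count equals \<open>n\<close>.
\<close>
lemma blue_time_eq_first:
  assumes "unit_steps \<omega>" "blue X m \<omega> = n" "\<And>m'. m' < m \<Longrightarrow> blue X m' \<omega> < n"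
  shows "blue_time X n \<omega> = enat m"
  using assms(2,3)
proof (induction n arbitrary: m)
  case 0
  then have "m = 0" by (cases m) auto
  then show ?case by (simp add: zero_enat_def)
next
  case (Suc n)
  have start: "blue X 0 \<omega> = 0" using assms(1) by (simp add: unit_steps_def blue_def)
  with Suc.prems obtain m1 where m1: "m = Suc m1" by (cases m) auto
  have step: "X (Suc m1) \<omega> \<in> {(Suc (fst (X m1 \<omega>)), snd (X m1 \<omega>)), (fst (X m1 \<omega>), Suc (snd (X m1 \<omega>)))}"
    using assms(1) unfolding unit_steps_def by blast
  have m1n: "blue X m1 \<omega> = n" using Suc.prems(1) Suc.prems(2)[of m1] step by (auto simp: m1 blue_def)
  define m0 where "m0 = (LEAST k. blue X k \<omega> = n)"
  have m0: "blue X m0 \<omega> = n" unfolding m0_def by (rule LeastI[of _ m1]) (rule m1n)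
  have m0_le: "m0 \<le> m1" unfolding m0_def by (rule Least_le) (rule m1n)
  have "blue X k \<omega> < n" if "k < m0" for k
  proof -
    have "blue X k \<omega> \<noteq> n" using that not_less_Least unfolding m0_def by blast
    moreover have "blue X k \<omega> \<le> n" using blue_mono[OF assms(1), of k m0] that m0 by simp
    ultimately show ?thesis by simp
  qed
  then have IH: "blue_time X n \<omega> = enat m0" using Suc.IH[OF m0] by blast
  show ?case unfolding blue_time.simps IH
  proof (rule antisym)
    show "Inf {enat k | k. enat k > enat m0 \<and> blue X k \<omega> = blue X (k - 1) \<omega> + 1} \<le> enat m"
      by (rule Inf_lower) (use m0_le m1 m1n Suc.prems(1) in auto)
    show "enat m \<le> Inf {enat k | k. enat k > enat m0 \<and> blue X k \<omega> = blue X (k - 1) \<omega> + 1}"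
    proof (rule Inf_greatest, clarsimp)
      fix k assume k: "m0 < k" "blue X k \<omega> = Suc (blue X (k - Suc 0) \<omega>)"
      have "blue X m0 \<omega> \<le> blue X (k - Suc 0) \<omega>" using k by (intro blue_mono assms(1)) auto
      then have "\<not> blue X k \<omega> < Suc n" using k m0 by simp
      then show "m \<le> k" using Suc.prems(2)[of k] by (meson not_less)
    qed
  qed
qed

definition stopped_at :: "nat \<Rightarrow> nat \<Rightarrow> 'a set" where
  "stopped_at n j = {\<omega> \<in> space M. blue_time X n \<omega> = enat (n + j) \<and> X (n + j) \<omega> = (n, j)}"

lemma sets_stopped_at [measurable]: "stopped_at n j \<in> sets M"
  unfolding stopped_at_def by measurable

text \<open>
  An inequality suffices here: when \<open>r\<close> tends to \<open>0\<close>, the probabilities \<open>blue_at n j\<close> sum to one, and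
  as the events \<open>stopped_at n j\<close> are disjoint, this forces equality.
\<close>
lemma blue_at_le_stopped: "blue_at n j \<le> prob (stopped_at n j)"
proof (cases n)
  case 0
  show ?thesis
  proof (cases "j = 0")
    case True
    have "prob (stopped_at 0 0) = 1"
      using start by (subst prob_eq_1) (auto simp: stopped_at_def zero_enat_def)
    with 0 True show ?thesis by (simp add: blue_at_0)
  qed (simp add: 0 blue_at_0)
next
  case (Suc k)
  have "blue_at n j = prob {\<omega> \<in> space M. X (k + j) \<omega> = (k, j) \<and> X (n + j) \<omega> = (n, j)}"
    by (simp add: blue_at_def Suc)
  also have "\<dots> \<le> prob (stopped_at n j)"
  proof (rule finite_measure_mono_AE)
    show "AE \<omega> in M. \<omega> \<in> {\<omega> \<in> space M. X (k + j) \<omega> = (k, j) \<and> X (n + j) \<omega> = (n, j)} \<longrightarrow> \<omega> \<in> stopped_at n j"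
      using AE_unit_steps
    proof eventually_elim
      case (elim \<omega>)
      show ?case
      proof
        assume \<omega>: "\<omega> \<in> {\<omega> \<in> space M. X (k + j) \<omega> = (k, j) \<and> X (n + j) \<omega> = (n, j)}"
        have "blue_time X n \<omega> = enat (n + j)"
        proof (rule blue_time_eq_first[OF elim])
          fix m' assume "m' < n + j"
          then have "blue X m' \<omega> \<le> blue X (k + j) \<omega>" using Suc by (intro blue_mono elim) auto
          then show "blue X m' \<omega> < n" using \<omega> Suc by (simp add: blue_def)
        qed (use \<omega> in \<open>simp add: blue_def\<close>)
        with \<omega> show "\<omega> \<in> stopped_at n j" by (simp add: stopped_at_def)
      qed
    qed
  qed measurable
  finally show ?thesis .
qed

lemma
  assumes r0: "r \<longlonglongrightarrow> 0"
  shows AE_stopped: "AE \<omega> in M. \<exists>j. \<omega> \<in> stopped_at n j"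
    and prob_stopped: "prob (stopped_at n j) = blue_at n j"
proof -
  have sums: "(\<lambda>j. prob (stopped_at n j)) sums prob (\<Union>j. stopped_at n j)"
    by (rule finite_measure_UNION) (auto simp: disjoint_family_on_def stopped_at_def)
  \<comment> \<open>Comparing the two series term by term leaves no room for a strict inequality.\<close>
  have "1 \<le> prob (\<Union>j. stopped_at n j)"
    by (rule sums_le[OF blue_at_le_stopped blue_at_sums_1[OF r0] sums])
  then have 1: "prob (\<Union>j. stopped_at n j) = 1" by (simp add: antisym)
  then show "AE \<omega> in M. \<exists>j. \<omega> \<in> stopped_at n j"
    by (subst (asm) prob_eq_1) auto
  have "(\<lambda>j. prob (stopped_at n j) - blue_at n j) sums 0"
    using sums_diff[OF sums[unfolded 1] blue_at_sums_1[OF r0]] by simp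
  then have "\<forall>j. prob (stopped_at n j) - blue_at n j = 0"
    using suminf_eq_zero_iff[of "\<lambda>j. prob (stopped_at n j) - blue_at n j"] blue_at_le_stopped
    by (simp add: sums_iff)
  then show "prob (stopped_at n j) = blue_at n j" by simp
qed

definition red_at_blue :: "nat \<Rightarrow> 'a \<Rightarrow> nat" where
  "red_at_blue n \<omega> = snd (X (the_enat (blue_time X n \<omega>)) \<omega>)"

lemma measurable_red_at_blue [measurable]: "red_at_blue n \<in> measurable M (count_space UNIV)"
  unfolding red_at_blue_def by (rule measurable_compose[OF measurable_state_at_blue]) simp

lemma distr_red_at_blue:
  assumes r0: "r \<longlonglongrightarrow> 0"
  shows "distr M (count_space UNIV) (red_at_blue n) = measure_pmf (red_law n)"
proof (rule measure_eqI_countable[where A = UNIV])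
  fix j
  have "emeasure (distr M (count_space UNIV) (red_at_blue n)) {j} = prob {\<omega> \<in> space M. red_at_blue n \<omega> = j}"
    by (subst emeasure_distr) (auto simp: emeasure_eq_measure vimage_def Int_def conj_commute)
  also have "prob {\<omega> \<in> space M. red_at_blue n \<omega> = j} = prob (stopped_at n j)"
  proof (rule measure_eq_AE)
    show "AE \<omega> in M. \<omega> \<in> {\<omega> \<in> space M. red_at_blue n \<omega> = j} \<longleftrightarrow> \<omega> \<in> stopped_at n j"
      using AE_stopped[OF r0, of n]
      by eventually_elim (auto simp: red_at_blue_def stopped_at_def)
  qed measurable
  finally show "emeasure (distr M (count_space UNIV) (red_at_blue n)) {j} = emeasure (measure_pmf (red_law n)) {j}"
    by (simp add: prob_stopped[OF r0] pmf_red_law[OF r0] emeasure_pmf_single)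
qed auto

lemma discrepancy_at_blue_law:
  assumes r0: "r \<longlonglongrightarrow> 0" and int: "integrable (measure_pmf (red_law n)) real"
  shows "mean_at_blue_exists M X n"
    and "expectation (discrepancy_at_blue X n) = measure_pmf.expectation (red_law n) (\<lambda>j. real j - real n)"
proof -
  have meas [measurable]: "discrepancy_at_blue X n \<in> borel_measurable M"
    unfolding discrepancy_at_blue_def discrepancy_def blue_def red_def
    by (rule measurable_compose[OF measurable_state_at_blue]) simp
  have AE: "AE \<omega> in M. discrepancy_at_blue X n \<omega> = real (red_at_blue n \<omega>) - real n"
    using AE_stopped[OF r0, of n]
    by eventually_elim (auto simp: red_at_blue_def stopped_at_def discrepancy_at_blue_def discrepancy_def blue_def red_def)
  have "integrable (measure_pmf (red_law n)) (\<lambda>j. real j - real n)" using int by simp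
  then have "integrable (distr M (count_space UNIV) (red_at_blue n)) (\<lambda>j. real j - real n)"
    unfolding distr_red_at_blue[OF r0] .
  then have "integrable M (\<lambda>\<omega>. real (red_at_blue n \<omega>) - real n)"
    by (subst (asm) integrable_distr_eq) auto
  then have "integrable M (discrepancy_at_blue X n)"
    by (subst integrable_cong_AE[OF _ _ AE]) auto
  moreover have "AE \<omega> in M. blue_time X n \<omega> < \<infinity>"
    using AE_stopped[OF r0, of n] by eventually_elim (auto simp: stopped_at_def)
  ultimately show "mean_at_blue_exists M X n" by (simp add: mean_at_blue_exists_def)
  have "expectation (discrepancy_at_blue X n) = expectation (\<lambda>\<omega>. real (red_at_blue n \<omega>) - real n)"
    by (rule integral_cong_AE[OF _ _ AE]) auto
  also have "\<dots> = integral\<^sup>L (distr M (count_space UNIV) (red_at_blue n)) (\<lambda>j. real j - real n)"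
    by (subst integral_distr) auto
  finally show "expectation (discrepancy_at_blue X n) = measure_pmf.expectation (red_law n) (\<lambda>j. real j - real n)"
    unfolding distr_red_at_blue[OF r0] .
qed

end

section \<open>The urns of the three types\<close>

text \<open>
  The law of the red count depends on the weights only through \<open>r j / b n\<close>, which is why a common factor
  \<open>a\<close> may be introduced to normalise the waiting times.
\<close>
lemma (in polya_urn) discrepancy_limit:
  assumes \<alpha>: "\<alpha> > 0" and a: "a > 0"
    and red: "(\<lambda>j. (1 / (a * r j) - real j powr \<alpha>) / real j powr (\<alpha> - 1)) \<longlonglongrightarrow> c"
    and blue: "(\<lambda>i. (1 / (a * b i) - real i powr \<alpha>) / real i powr (\<alpha> - 1)) \<longlonglongrightarrow> c'"
  shows "\<forall>n. mean_at_blue_exists M X n"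
    and "(\<lambda>n. expectation (discrepancy_at_blue X n)) \<longlonglongrightarrow> (c' - c) / \<alpha> - \<alpha> / (2 * \<alpha> + 1)"
proof -
  note asymp = first_order_of_second_order[OF red]
  have top: "filterlim (\<lambda>j. 1 / (a * r j)) at_top sequentially"
    by (rule filterlim_of_powr_asymp[OF asymp \<alpha>])
  have "(\<lambda>j. 1 / a * inverse (1 / (a * r j))) \<longlonglongrightarrow> 1 / a * 0"
    by (intro tendsto_intros tendsto_inverse_0_at_top top)
  then have r0: "r \<longlonglongrightarrow> 0" using a by simp
  interpret power_law_waits "\<lambda>i. 1 / (a * b i)" "\<lambda>j. 1 / (a * r j)" red_law \<alpha> c c'
  proof
    show "red_law 0 = return_pmf 0"
      by (intro pmf_eqI) (simp add: pmf_red_law[OF r0] blue_at_0 indicator_def)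
    show "poly_bounded (\<lambda>j. 1 / (a * r j))" by (rule poly_bounded_of_powr_asymp[OF asymp \<alpha>])
    show "pmf (red_law (Suc n)) j * (1 + 1 / (a * b n) / (1 / (a * r j))) =
        pmf (red_law n) j + (if j = 0 then 0 else pmf (red_law (Suc n)) (j - 1) * (1 / (a * b n) / (1 / (a * r (j - 1)))))" for n j
      using blue_at_balance[of n j] a by (simp add: pmf_red_law[OF r0])
  qed (use a \<alpha> blue_weights_pos red_weights_pos red blue top in auto)
  note law = discrepancy_at_blue_law[OF r0 integrable_P[OF poly_bounded_of_nat]]
  show "\<forall>n. mean_at_blue_exists M X n" using law(1) by blast
  show "(\<lambda>n. expectation (discrepancy_at_blue X n)) \<longlonglongrightarrow> (c' - c) / \<alpha> - \<alpha> / (2 * \<alpha> + 1)"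
    unfolding law(2) by (rule red_excess_limit)
qed

text \<open>
  Dividing by \<open>2 powr \<alpha>\<close> turns \<open>(2 * i + d) powr \<alpha>\<close> into \<open>(i + d / 2) powr \<alpha>\<close>; the shift by \<open>d / 2\<close>
  contributes \<open>d * \<alpha> / 2\<close> to the coefficient of \<open>i powr (\<alpha> - 1)\<close>, while \<open>2 * B / (2 * i)\<close> contributes
  \<open>B\<close>.
\<close>
lemma arithmetic_subsequence_asymp:
  fixes \<alpha> B :: real and w err :: "nat \<Rightarrow> real" and d :: nat
  assumes \<alpha>: "\<alpha> > 0" and err: "err \<in> O(\<lambda>n. 1 / real n ^ 2)"
    and w: "eventually (\<lambda>n. 1 / w n = real n powr \<alpha> * (1 + 2 * B / real n + err n)) sequentially"
  shows "(\<lambda>i. (1 / (2 powr \<alpha> * w (2 * i + d)) - real i powr \<alpha>) / real i powr (\<alpha> - 1))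
    \<longlonglongrightarrow> B + real d * \<alpha> / 2"
proof (rule Lim_transform_eventually)
  define k where "k i = 2 * i + d" for i
  have k_top: "filterlim k at_top sequentially" unfolding k_def by (rule filterlim_subseq) (auto simp: strict_mono_def)
  define D where "D = real d / 2"
  have D: "D \<ge> 0" by (simp add: D_def)
  have kD: "real (k i) = 2 * (real i + D)" for i by (simp add: k_def D_def)
  have "(\<lambda>n. 1 / real n ^ 2) \<in> o(\<lambda>n. 1 / real n)" by real_asymp
  with err have "err \<in> o(\<lambda>n. 1 / real n)" by (rule landau_o.big_small_trans)
  from smalloD_tendsto[OF this] have "(\<lambda>n. err n * real n) \<longlonglongrightarrow> 0" by simp
  from filterlim_compose[OF this k_top] have e: "(\<lambda>i. err (k i) * real (k i)) \<longlonglongrightarrow> 0" .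
  have l1: "(\<lambda>i. ((real i + D) powr \<alpha> - real i powr \<alpha>) / real i powr (\<alpha> - 1)) \<longlonglongrightarrow> D * \<alpha>"
    using \<alpha> D by real_asymp
  have l2: "(\<lambda>i. (real i + D) powr \<alpha> / real i powr (\<alpha> - 1) / (real i + D)) \<longlonglongrightarrow> 1"
    using \<alpha> D by real_asymp
  have "(\<lambda>i. ((real i + D) powr \<alpha> - real i powr \<alpha>) / real i powr (\<alpha> - 1)
      + (real i + D) powr \<alpha> / real i powr (\<alpha> - 1) / (real i + D) * (B + err (k i) * real (k i) / 2))
      \<longlonglongrightarrow> D * \<alpha> + 1 * (B + 0 / 2)"
    by (intro tendsto_intros l1 l2 e) simp
  then show "(\<lambda>i. ((real i + D) powr \<alpha> - real i powr \<alpha>) / real i powr (\<alpha> - 1)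
      + (real i + D) powr \<alpha> / real i powr (\<alpha> - 1) / (real i + D) * (B + err (k i) * real (k i) / 2))
      \<longlonglongrightarrow> B + real d * \<alpha> / 2" by (simp add: D_def add.commute)
  show "eventually (\<lambda>i. ((real i + D) powr \<alpha> - real i powr \<alpha>) / real i powr (\<alpha> - 1)
      + (real i + D) powr \<alpha> / real i powr (\<alpha> - 1) / (real i + D) * (B + err (k i) * real (k i) / 2) =
      (1 / (2 powr \<alpha> * w (2 * i + d)) - real i powr \<alpha>) / real i powr (\<alpha> - 1)) sequentially"
    using eventually_compose_filterlim[OF w k_top] eventually_gt_at_top[of 0]
  proof eventually_elim
    case (elim i)
    define q where "q = real i + D"
    have q: "q > 0" using elim D by (simp add: q_def)
    have "1 / (2 powr \<alpha> * w (k i)) = 1 / w (k i) / 2 powr \<alpha>" by simp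
    also have "\<dots> = q powr \<alpha> * (1 + 2 * B / (2 * q) + err (k i))"
      unfolding elim(1) kD using q by (simp add: q_def[symmetric] powr_mult)
    also have "\<dots> = q powr \<alpha> + q powr \<alpha> / q * (B + err (k i) * real (k i) / 2)"
      unfolding kD q_def[symmetric] using q by (simp add: field_simps)
    finally show ?case
      by (simp add: k_def[symmetric] q_def[symmetric] add_divide_distrib diff_divide_distrib)
  qed
qed

theorem proposition3p9:
  fixes \<alpha> B :: real and w err :: "nat \<Rightarrow> real"
    and M\<^sub>p :: "'a measure" and X\<^sub>p :: "nat \<Rightarrow> 'a \<Rightarrow> nat \<times> nat"
    and M\<^sub>m :: "'b measure" and X\<^sub>m :: "nat \<Rightarrow> 'b \<Rightarrow> nat \<times> nat"
    and M\<^sub>z :: "'c measure" and X\<^sub>z :: "nat \<Rightarrow> 'c \<Rightarrow> nat \<times> nat"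
  assumes "\<alpha> > 0"
    and "\<And>n. w n > 0"
    and "err \<in> O(\<lambda>n. 1 / real n ^ 2)"
    and "eventually (\<lambda>n. 1 / w n = real n powr \<alpha> * (1 + 2 * B / real n + err n)) sequentially"
    and "typed_urn Urn_Plus w M\<^sub>p X\<^sub>p"
    and "typed_urn Urn_Minus w M\<^sub>m X\<^sub>m"
    and "typed_urn Urn_Zero w M\<^sub>z X\<^sub>z"
  shows "(\<forall>n. mean_at_blue_exists M\<^sub>p X\<^sub>p n) \<and>
         (\<lambda>n. prob_space.expectation M\<^sub>p (discrepancy_at_blue X\<^sub>p n))
           \<longlonglongrightarrow> 1 / (2 * (2 * \<alpha> + 1)) \<and>
         (\<forall>n. mean_at_blue_exists M\<^sub>m X\<^sub>m n) \<and>
         (\<lambda>n. prob_space.expectation M\<^sub>m (discrepancy_at_blue X\<^sub>m n))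
           \<longlonglongrightarrow> - (4 * \<alpha> + 1) / (2 * (2 * \<alpha> + 1)) \<and>
         (\<forall>n. mean_at_blue_exists M\<^sub>z X\<^sub>z n) \<and>
         (\<lambda>n. prob_space.expectation M\<^sub>z (discrepancy_at_blue X\<^sub>z n))
           \<longlonglongrightarrow> - \<alpha> / (2 * \<alpha> + 1)"
proof -
  have pos: "(2::real) powr \<alpha> > 0" by simp
  note waits = arithmetic_subsequence_asymp[OF assms(1,3,4)]
  have even: "(\<lambda>i. (1 / (2 powr \<alpha> * w (2 * i)) - real i powr \<alpha>) / real i powr (\<alpha> - 1)) \<longlonglongrightarrow> B"
    using waits[of 0] by simp
  have odd: "(\<lambda>i. (1 / (2 powr \<alpha> * w (2 * i + 1)) - real i powr \<alpha>) / real i powr (\<alpha> - 1)) \<longlonglongrightarrow> B + \<alpha> / 2"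
    using waits[of 1] by simp
  have weights: "blue_weight Urn_Plus w = (\<lambda>i. w (2 * i + 1))" "red_weight Urn_Plus w = (\<lambda>i. w (2 * i))"
    "blue_weight Urn_Minus w = (\<lambda>i. w (2 * i))" "red_weight Urn_Minus w = (\<lambda>i. w (2 * i + 1))"
    "blue_weight Urn_Zero w = (\<lambda>i. w (2 * i))" "red_weight Urn_Zero w = (\<lambda>i. w (2 * i))"
    by (rule ext, simp)+
  interpret p: polya_urn M\<^sub>p "\<lambda>i. w (2 * i + 1)" "\<lambda>i. w (2 * i)" X\<^sub>p
    using assms(5) unfolding typed_urn_def weights .
  interpret m: polya_urn M\<^sub>m "\<lambda>i. w (2 * i)" "\<lambda>i. w (2 * i + 1)" X\<^sub>m
    using assms(6) unfolding typed_urn_def weights .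
  interpret z: polya_urn M\<^sub>z "\<lambda>i. w (2 * i)" "\<lambda>i. w (2 * i)" X\<^sub>z
    using assms(7) unfolding typed_urn_def weights .
  have "(B + \<alpha> / 2 - B) / \<alpha> - \<alpha> / (2 * \<alpha> + 1) = 1 / (2 * (2 * \<alpha> + 1))"
    "(B - (B + \<alpha> / 2)) / \<alpha> - \<alpha> / (2 * \<alpha> + 1) = - (4 * \<alpha> + 1) / (2 * (2 * \<alpha> + 1))"
    "(B - B) / \<alpha> - \<alpha> / (2 * \<alpha> + 1) = - \<alpha> / (2 * \<alpha> + 1)"
    using assms(1) by (simp_all add: field_simps)
  then show ?thesis
    using p.discrepancy_limit[OF assms(1) pos even odd] m.discrepancy_limit[OF assms(1) pos odd even]
      z.discrepancy_limit[OF assms(1) pos even even]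
    by (simp only: simp_thms)
qed

end
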